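(* Let $\tau>0$ and $n\ge0$, and let $(\psi_{+,h}^{n},\psi_{-,h}^{n},\phi_h^{n-1/2},Z_{+,h}^{n-1/2},Z_{-,h}^{n-1/2})\in\mathbf{V}_h\times\mathbf{V}_h\times\mathring V_h\times V_h\times V_h$ be given. Assume that $$\int_\Omega|\psi_{+,h}^n|^2-|\psi_{-,h}^n|^2\,dx=0\qquad\text{and}\qquad\int_\Omega Z_{+,h}^{n-1/2}-Z_{-,h}^{n-1/2}\,dx=0.$$ Then there exists a unique $$(\psi_{+,h}^{n+1},\psi_{-,h}^{n+1},\phi_h^{n+1/2},Z_{+,h}^{n+1/2},Z_{-,h}^{n+1/2})\in\mathbf{V}_h\times\mathbf{V}_h\times\mathring V_h\times V_h\times V_h$$ such that for all $(v_+,v_-,w,\chi_+,\chi_-)\in\mathbf{V}_h\times\mathbf{V}_h\times V_h\times V_h\times V_h$ $$\langle\mathbf{i}D_\tau\psi_{+,h}^{n+1},v_+\rangle=\tfrac12A_0(\bar\psi_{+,h}^{n+1/2},v_+)+\langle(gZ_{+,h}^{n+1/2}+GZ_{-,h}^{n+1/2}+q\phi_h^{n+1/2})\bar\psi_{+,h}^{n+1/2},v_+\rangle,$$ $$\langle\mathbf{i}D_\tau\psi_{-,h}^{n+1},v_-\rangle=\tfrac12A_0(\bar\psi_{-,h}^{n+1/2},v_-)+\langle(gZ_{-,h}^{n+1/2}+GZ_{+,h}^{n+1/2}-q\phi_h^{n+1/2})\bar\psi_{-,h}^{n+1/2},v_-\rangle,$$ $$A_1(\phi_h^{n+1/2},w)=(4\pi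 q(Z_{+,h}^{n+1/2}-Z_{-,h}^{n+1/2}),w),$$ $$(Z_{+,h}^{n+1/2}+Z_{+,h}^{n-1/2},\chi_+)=(2|\psi_{+,h}^n|^2,\chi_+),$$ $$(Z_{-,h}^{n+1/2}+Z_{-,h}^{n-1/2},\chi_-)=(2|\psi_{-,h}^n|^2,\chi_-).$$
   Context: $\Omega\subset\mathbb{R}^d$, $d\in\{1,2,3\}$, is a bounded domain on which periodic boundary conditions are imposed; $g,G,q$ are real parameters; $\mathbf{i}=\sqrt{-1}$. $\langle u,v\rangle=\int_\Omega uv^*dx$ is the inner product of the complex-valued space $\mathbf{L}^2(\Omega)$ ($v^*$ is the complex conjugate of $v$), and $(u,v)=\int_\Omega uv\,dx$ that of the real-valued space $L^2(\Omega)$. $\mathbf{V}=\mathbf{H}^1_{\rm per}(\Omega)$ (complex-valued) and $V=H^1_{\rm per}(\Omega)$ (real-valued) are the subspaces of the respective Sobolev spaces $H^1$ of functions periodic in each coordinate direction, and $\mathring V=\{v\in V:\int_\Omega v\,dx=0\}$. $A_0(w,v)=\langle\nabla w,\nabla v\rangle$ and $A_1(w,v)=(\nabla w,\nabla v)$. $\mathcal{T}_h=\{K\}$ is a partition of $\Omega$ into shape-regular elements. For an integer $k\ge1$, $V_h$ (resp. $\mathbf{V}_h$) is the space of continuous functions in $V$ (resp. $\mathbf{V}$) whose restriction to each $K\in\mathcal{T}_h$ is a real-valued (resp. complex-valued) polynomial of degree at most $k$; $\mathring V_h=V_h\cap\mathring V$. Notation: $D_\tau v^{n+1}=(v^{n+1}-v^n)/\tau$,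 $\bar v^{n+1/2}=(v^{n+1}+v^n)/2$. *)

theory Defs
  imports "HOL-Analysis.Analysis"
begin

text \<open>
  Functions on the periodic domain are represented by their periodic extensions to
  all of \<^typ>\<open>real^'n\<close>.  The value type \<^typ>\<open>'b\<close> is instantiated with
  \<^typ>\<open>real\<close> and with \<^typ>\<open>complex\<close> to obtain the real-valued and
  the complex-valued spaces.
\<close>

definition pderivative :: "'n \<Rightarrow> (real^'n \<Rightarrow> real) \<Rightarrow> real^'n \<Rightarrow> real" where
  "pderivative i f x = deriv (\<lambda>t. f (x + t *\<^sub>R axis i 1)) 0"

fun C_k :: "nat \<Rightarrow> (real^'n \<Rightarrow> real) \<Rightarrow> bool" where
  "C_k 0 f \<longleftrightarrow> continuous_on UNIV f"
| "C_k (Suc m) f \<longleftrightarrow> continuous_on UNIV f \<and>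
     (\<forall>i. (\<forall>x. (\<lambda>t. f (x + t *\<^sub>R axis i 1)) field_differentiable at 0) \<and>
          C_k m (pderivative i f))"

definition test_functions :: "(real^'n) set \<Rightarrow> (real^'n \<Rightarrow> real) set" where
  "test_functions S =
     {\<theta>. (\<forall>m. C_k m \<theta>) \<and> compact (closure {x. \<theta> x \<noteq> 0}) \<and> closure {x. \<theta> x \<noteq> 0} \<subseteq> S}"

definition L2 :: "(real^'n) set \<Rightarrow> (real^'n \<Rightarrow> 'b::euclidean_space) set" where
  "L2 S = {u. u \<in> borel_measurable (lebesgue_on S) \<and>
              integrable (lebesgue_on S) (\<lambda>x. (norm (u x))\<^sup>2)}"

definition has_weak_gradient ::
    "(real^'n \<Rightarrow> 'b::euclidean_space) \<Rightarrow> (real^'n \<Rightarrow> 'b^'n) \<Rightarrow> (real^'n) set \<Rightarrow> bool" where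
  "has_weak_gradient u F S \<longleftrightarrow>
     (\<forall>\<theta>\<in>test_functions S. \<forall>i.
        (\<integral>x. pderivative i \<theta> x *\<^sub>R u x \<partial>lebesgue_on S) =
        - (\<integral>x. \<theta> x *\<^sub>R (F x $ i) \<partial>lebesgue_on S))"

definition H1 :: "(real^'n) set \<Rightarrow> (real^'n \<Rightarrow> 'b::euclidean_space) set" where
  "H1 S = {u \<in> L2 S. \<exists>F\<in>L2 S. has_weak_gradient u F S}"

text \<open>A representative of the weak gradient, which is determined only almost everywhere.\<close>

definition weak_grad ::
    "(real^'n) set \<Rightarrow> (real^'n \<Rightarrow> 'b::euclidean_space) \<Rightarrow> real^'n \<Rightarrow> 'b^'n" where
  "weak_grad S u = (SOME F. F \<in> L2 S \<and> has_weak_gradient u F S)"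

definition periodic :: "real^'n \<Rightarrow> (real^'n \<Rightarrow> 'b) \<Rightarrow> bool" where
  "periodic p u \<longleftrightarrow> (\<forall>i x. u (x + (p $ i) *\<^sub>R axis i 1) = u x)"

text \<open>
  Requiring \<open>H1\<close> on every bounded open set, and not just on \<open>box a b\<close>, is what
  makes the traces on opposite faces of the box agree.
\<close>

definition H1_per :: "real^'n \<Rightarrow> real^'n \<Rightarrow> (real^'n \<Rightarrow> 'b::euclidean_space) set" where
  "H1_per a b = {u. periodic (b - a) u \<and> (\<forall>S. open S \<and> bounded S \<longrightarrow> u \<in> H1 S)}"

definition H1_per_mean0 :: "real^'n \<Rightarrow> real^'n \<Rightarrow> (real^'n \<Rightarrow> real) set" where
  "H1_per_mean0 a b = {v \<in> H1_per a b. (\<integral>x. v x \<partial>lebesgue_on (box a b)) = 0}"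

definition inner_C :: "(real^'n) set \<Rightarrow> (real^'n \<Rightarrow> complex) \<Rightarrow> (real^'n \<Rightarrow> complex) \<Rightarrow> complex" where
  "inner_C S u v = (\<integral>x. u x * cnj (v x) \<partial>lebesgue_on S)"

definition inner_R :: "(real^'n) set \<Rightarrow> (real^'n \<Rightarrow> real) \<Rightarrow> (real^'n \<Rightarrow> real) \<Rightarrow> real" where
  "inner_R S u v = (\<integral>x. u x * v x \<partial>lebesgue_on S)"

definition A0 :: "(real^'n) set \<Rightarrow> (real^'n \<Rightarrow> complex) \<Rightarrow> (real^'n \<Rightarrow> complex) \<Rightarrow> complex" where
  "A0 S w v = (\<integral>x. (\<Sum>i\<in>UNIV. weak_grad S w x $ i * cnj (weak_grad S v x $ i)) \<partial>lebesgue_on S)"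

definition A1 :: "(real^'n) set \<Rightarrow> (real^'n \<Rightarrow> real) \<Rightarrow> (real^'n \<Rightarrow> real) \<Rightarrow> real" where
  "A1 S w v = (\<integral>x. (\<Sum>i\<in>UNIV. weak_grad S w x $ i * weak_grad S v x $ i) \<partial>lebesgue_on S)"

text \<open>
  The elements are not restricted to a particular shape, and hanging nodes are not
  excluded.  As the elements are closed, they partition the closure \<open>cbox a b\<close>
  up to common boundary points.
\<close>

definition mesh :: "real^'n \<Rightarrow> real^'n \<Rightarrow> (real^'n) set set \<Rightarrow> bool" where
  "mesh a b \<T> \<longleftrightarrow>
     finite \<T> \<and>
     (\<forall>K\<in>\<T>. compact K \<and> connected K \<and> interior K \<noteq> {} \<and> closure (interior K) = K) \<and>
     (\<forall>K\<in>\<T>. \<forall>K'\<in>\<T>. K \<noteq> K' \<longrightarrow> interior K \<inter> interior K' = {}) \<and>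
     \<Union>\<T> = cbox a b"

text \<open>The supremum of the diameters of the balls contained in \<open>K\<close>.\<close>

definition inball_diameter :: "(real^'n) set \<Rightarrow> real" where
  "inball_diameter K = Sup {2 * r | r c. 0 \<le> r \<and> ball c r \<subseteq> K}"

definition shape_regular :: "real \<Rightarrow> (real^'n) set set \<Rightarrow> bool" where
  "shape_regular \<sigma> \<T> \<longleftrightarrow> (\<forall>K\<in>\<T>. diameter K \<le> \<sigma> * inball_diameter K)"

definition polynomial_deg_le :: "nat \<Rightarrow> (real^'n \<Rightarrow> 'b::real_vector) \<Rightarrow> bool" where
  "polynomial_deg_le k p \<longleftrightarrow>
     (\<exists>c. \<forall>x. p x = (\<Sum>\<alpha> | (\<Sum>i\<in>UNIV. \<alpha> i) \<le> k. (\<Prod>i\<in>UNIV. (x $ i) ^ \<alpha> i) *\<^sub>R c \<alpha>))"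

definition fe_space ::
    "real^'n \<Rightarrow> real^'n \<Rightarrow> (real^'n) set set \<Rightarrow> nat \<Rightarrow> (real^'n \<Rightarrow> 'b::euclidean_space) set" where
  "fe_space a b \<T> k =
     {v \<in> H1_per a b. continuous_on UNIV v \<and>
        (\<forall>K\<in>\<T>. \<exists>p. polynomial_deg_le k p \<and> (\<forall>x\<in>K. v x = p x))}"

definition fe_space_mean0 ::
    "real^'n \<Rightarrow> real^'n \<Rightarrow> (real^'n) set set \<Rightarrow> nat \<Rightarrow> (real^'n \<Rightarrow> real) set" where
  "fe_space_mean0 a b \<T> k = fe_space a b \<T> k \<inter> H1_per_mean0 a b"

text \<open>In both operators the value at the new time level comes first.\<close>

definition D_tau :: "real \<Rightarrow> ('a \<Rightarrow> complex) \<Rightarrow> ('a \<Rightarrow> complex) \<Rightarrow> 'a \<Rightarrow> complex" where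
  "D_tau \<tau> v' v x = (v' x - v x) / complex_of_real \<tau>"

definition midpt :: "('a \<Rightarrow> complex) \<Rightarrow> ('a \<Rightarrow> complex) \<Rightarrow> 'a \<Rightarrow> complex" where
  "midpt v' v x = (v' x + v x) / 2"

end

theory Submission
  imports Defs "HOL-Library.Function_Algebras" "HOL-Computational_Algebra.Polynomial"
begin

text \<open>
  The five equations decouple and can be solved one after the other. The last two determine
  \<open>Z\<^sub>+\<close> and \<open>Z\<^sub>-\<close> as \<open>L\<^sup>2\<close> projections onto the finite element space. Once they are known,
  the third is a discrete Poisson equation; testing the equations for \<open>Z\<^sub>+\<close> and \<open>Z\<^sub>-\<close> with the
  constant 1 and using the two integral hypotheses shows that its right-hand side has mean value
  zero, so it is uniquely solvable among the functions of mean value zero. With \<open>Z\<^sub>+\<close>,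
  \<open>Z\<^sub>-\<close> and \<open>\<phi>\<close> known, the first two equations are linear in the new wave functions, or
  equivalently in the midpoints \<open>m = (\<psi>' + \<psi>) / 2\<close>: each of them reads
  \<open>(2\<i>/\<tau>) \<langle>m, v\<rangle> - A\<^sub>0(m, v)/2 - \<langle>W m, v\<rangle> = (2\<i>/\<tau>) \<langle>\<psi>, v\<rangle>\<close>
  with a real-valued function \<open>W\<close>.

  All these problems are square, that is, test and trial space agree and have finite dimension,
  and in each of them the (real) bilinear form does not vanish at a pair \<open>(v, v)\<close> with
  \<open>v \<noteq> 0\<close>; this gives unique solvability (\<open>unique_representative\<close>). For the projections the
  form is the inner product. For the Poisson equation it is \<open>A\<^sub>1\<close>, and \<open>A\<^sub>1(v, v) = 0\<close>
  makes \<open>v\<close> constant on the box. For the midpoints it is the imaginary part of the left-hand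
  side, which equals \<open>(2/\<tau>) \<parallel>v\<parallel>\<^sup>2\<close> at \<open>(v, v)\<close>.

  The analytic work lies in the weak gradients, which are chosen representatives.
  That \<open>A\<^sub>0\<close> and \<open>A\<^sub>1\<close> are sesquilinear and bilinear rests on uniqueness almost everywhere
  (\<open>weak_gradient_unique\<close>), hence on the fundamental lemma of the calculus of variations; that a
  continuous function with vanishing weak gradient is constant on a box is
  \<open>zero_weak_gradient_imp_constant\<close>. Both only need test functions that are products of
  functions of one coordinate.
\<close>

section \<open>Square linear problems on finite-dimensional subspaces\<close>

text \<open>
  Functions with values in a real vector space form a real vector space with pointwise
  operations, so that the notions of subspace and span apply to spaces of functions.
\<close>

instantiation "fun" :: (type, real_vector) real_vector
begin

definition scaleR_fun :: "real \<Rightarrow> ('a \<Rightarrow> 'b) \<Rightarrow> 'a \<Rightarrow> 'b" where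
  "scaleR_fun r f = (\<lambda>x. r *\<^sub>R f x)"

instance
  by standard (auto simp: scaleR_fun_def fun_eq_iff algebra_simps)

end

text \<open>
  Linearity of a functional on a subset, normally a subspace; the Dirichlet forms below are
  linear on functions that have a weak gradient, not on all functions.
\<close>

definition linear_on :: "'v::real_vector set \<Rightarrow> ('v \<Rightarrow> real) \<Rightarrow> bool" where
  "linear_on E f \<longleftrightarrow> (\<forall>u\<in>E. \<forall>v\<in>E. f (u + v) = f u + f v) \<and> (\<forall>c. \<forall>u\<in>E. f (c *\<^sub>R u) = c * f u)"

lemma linear_onD:
  assumes "linear_on E f"
  shows "u \<in> E \<Longrightarrow> v \<in> E \<Longrightarrow> f (u + v) = f u + f v" "u \<in> E \<Longrightarrow> f (c *\<^sub>R u) = c * f u"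
  using assms by (auto simp: linear_on_def)

lemma linear_on_diff:
  assumes "linear_on E f" "subspace E" "u \<in> E" "v \<in> E"
  shows "f (u - v) = f u - f v"
proof -
  have "f (u + (-1) *\<^sub>R v) = f u + f ((-1) *\<^sub>R v)"
    by (rule linear_onD(1)[OF assms(1,3) subspace_scale[OF assms(2,4)]])
  then show ?thesis using linear_onD(2)[OF assms(1,4), of "-1"] by simp
qed

text \<open>
  Induction on the spanning set. If \<open>p\<close> represents \<open>\<beta> a\<close> on \<open>span C\<close>, then
  \<open>z = a - p\<close> satisfies \<open>\<beta> z v = 0\<close> for all \<open>v\<close> in \<open>span C\<close>, and a solution on \<open>span C\<close> is
  corrected by a multiple of \<open>z\<close>.
\<close>

lemma exists_representative_span:
  fixes E :: "'v::real_vector set" and \<beta> :: "'v \<Rightarrow> 'v \<Rightarrow> real"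
  assumes E: "subspace E"
    and l: "\<And>v. v \<in> E \<Longrightarrow> linear_on E (\<lambda>u. \<beta> u v)" and r: "\<And>u. u \<in> E \<Longrightarrow> linear_on E (\<beta> u)"
    and def: "\<And>v. v \<in> E \<Longrightarrow> \<beta> v v = 0 \<Longrightarrow> v = 0"
    and "finite C" "C \<subseteq> E" "linear_on E f"
  shows "\<exists>m\<in>span C. \<forall>v\<in>span C. \<beta> m v = f v"
  using assms(5-7)
proof (induction C arbitrary: f rule: finite_induct)
  case empty
  have "0 \<in> E" using E by (rule subspace_0)
  then have "\<beta> 0 0 = 0" "f 0 = 0"
    using linear_onD(2)[OF r, of 0 0 0] linear_onD(2)[OF empty(2), of 0 0] by auto
  then show ?case by simp
next
  case (insert a C)
  have aE: "a \<in> E" and CE: "C \<subseteq> E" using insert.prems by auto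
  have sC: "span C \<subseteq> E" by (meson CE E span_minimal)
  from insert.IH[OF CE r[OF aE]] obtain p where p: "p \<in> span C" "\<And>v. v \<in> span C \<Longrightarrow> \<beta> p v = \<beta> a v" by auto
  from insert.IH[OF CE insert.prems(2)] obtain m where m: "m \<in> span C" "\<And>v. v \<in> span C \<Longrightarrow> \<beta> m v = f v"
    by auto
  have pE: "p \<in> E" and mE: "m \<in> E" using p m sC by auto
  define z where "z = a - p"
  have zE: "z \<in> E" unfolding z_def using aE pE E by (rule subspace_diff[rotated])
  have z0: "\<beta> z v = 0" if "v \<in> span C" for v
  proof -
    have "v \<in> E" using that sC by auto
    then show ?thesis unfolding z_def using linear_on_diff[OF l E aE pE, of v] p(2)[OF that] by simp
  qed
  show ?case
  proof (cases "z = 0")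
    case True
    then have "a \<in> span C" using p by (simp add: z_def)
    then have "span (insert a C) = span C" by (simp add: span_redundant)
    then show ?thesis using m by auto
  next
    case False
    then have bz: "\<beta> z z \<noteq> 0" using def[OF zE] by auto
    define c where "c = (f z - \<beta> m z) / \<beta> z z"
    have cz: "c *\<^sub>R z \<in> E" using zE E by (simp add: subspace_scale)
    define w where "w = m + c *\<^sub>R z"
    have w: "\<beta> w v = \<beta> m v + c * \<beta> z v" if "v \<in> E" for v
      unfolding w_def using linear_onD(1)[OF l[OF that] mE cz] linear_onD(2)[OF l[OF that] zE] by simp
    have wE: "w \<in> E" unfolding w_def using mE cz E by (rule subspace_add[rotated])
    have "\<beta> w v = f v" if v: "v \<in> span (insert a C)" for v
    proof -
      obtain t where t: "v - t *\<^sub>R a \<in> span C" using v by (auto simp: span_insert)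
      define y where "y = (v - t *\<^sub>R a) + t *\<^sub>R p"
      have y: "y \<in> span C" unfolding y_def using t p by (intro span_add span_scale) auto
      have yE: "y \<in> E" using y sC by auto
      have v: "v = y + t *\<^sub>R z" by (simp add: y_def z_def algebra_simps)
      have tz: "t *\<^sub>R z \<in> E" using zE E by (simp add: subspace_scale)
      have "\<beta> w v = \<beta> w y + t * \<beta> w z"
        unfolding v using linear_onD(1)[OF r[OF wE] yE tz] linear_onD(2)[OF r[OF wE] zE] by simp
      also have "\<beta> w y = f y" using w[OF yE] m(2)[OF y] z0[OF y] by simp
      also have "\<beta> w z = f z" using w[OF zE] bz by (simp add: c_def)
      also have "f y + t * f z = f v"
        unfolding v using linear_onD(1)[OF insert.prems(2) yE tz] linear_onD(2)[OF insert.prems(2) zE] by simp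
      finally show ?thesis .
    qed
    moreover have "w \<in> span (insert a C)"
    proof -
      have "m \<in> span (insert a C)" "p \<in> span (insert a C)"
        using m(1) p(1) span_mono[of C "insert a C"] by auto
      then show ?thesis unfolding w_def z_def
        by (intro span_add span_scale span_diff) (auto intro: span_base)
    qed
    ultimately show ?thesis by blast
  qed
qed

lemma finite_basis_of_subspace:
  fixes E :: "'v::real_vector set"
  assumes E: "subspace E" and "finite B" "E \<subseteq> span B"
  obtains C where "finite C" "C \<subseteq> E" "span C = E"
proof -
  obtain C where C: "C \<subseteq> E" "independent C" "E \<subseteq> span C"
    using maximal_independent_subset[of E] by metis
  have "finite C"
    using independent_span_bound[OF assms(2) C(2)] C(1) assms(3) by auto
  moreover have "span C = E" using C E span_minimal[of C E] by auto
  ultimately show thesis using that C by auto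
qed

text \<open>
  On a finite-dimensional space a bilinear form with \<open>\<beta> v v \<noteq> 0\<close> for all \<open>v \<noteq> 0\<close> represents
  every linear functional; no symmetry is required.
\<close>

lemma unique_representative:
  fixes E :: "'v::real_vector set" and \<beta> :: "'v \<Rightarrow> 'v \<Rightarrow> real"
  assumes E: "subspace E" and B: "finite B" "E \<subseteq> span B"
    and l: "\<And>v. v \<in> E \<Longrightarrow> linear_on E (\<lambda>u. \<beta> u v)" and r: "\<And>u. u \<in> E \<Longrightarrow> linear_on E (\<beta> u)"
    and def: "\<And>v. v \<in> E \<Longrightarrow> \<beta> v v = 0 \<Longrightarrow> v = 0"
    and f: "linear_on E f"
  shows "\<exists>!m. m \<in> E \<and> (\<forall>v\<in>E. \<beta> m v = f v)"
proof -
  obtain C where C: "finite C" "C \<subseteq> E" "span C = E" using finite_basis_of_subspace[OF E B] .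
  have "\<exists>m\<in>span C. \<forall>v\<in>span C. \<beta> m v = f v"
    by (rule exists_representative_span[OF E _ _ _ C(1,2) f]) (fact l r def)+
  then obtain m where m: "m \<in> E" "\<forall>v\<in>E. \<beta> m v = f v"
    unfolding C(3) by blast
  moreover have "m' = m" if "m' \<in> E" "\<forall>v\<in>E. \<beta> m' v = f v" for m'
  proof -
    have d: "m' - m \<in> E" using that m E by (simp add: subspace_diff)
    have "\<beta> (m' - m) (m' - m) = 0"
      using linear_on_diff[OF l[OF d] E that(1) m(1)] that m d by simp
    then show ?thesis using def[OF d] by simp
  qed
  ultimately show ?thesis by blast
qed

section \<open>Smooth bump functions\<close>

text \<open>
  \<open>ndiff m f\<close> states that \<open>f\<close> is \<open>m\<close> times continuously differentiable on the real line.
\<close>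

fun ndiff :: "nat \<Rightarrow> (real \<Rightarrow> real) \<Rightarrow> bool" where
  "ndiff 0 f \<longleftrightarrow> continuous_on UNIV f"
| "ndiff (Suc m) f \<longleftrightarrow> (\<exists>f'. (\<forall>x. (f has_real_derivative f' x) (at x)) \<and> ndiff m f')"

lemma ndiff_SucD: "ndiff (Suc m) f \<Longrightarrow> ndiff m f"
proof (induction m arbitrary: f)
  case 0
  then show ?case by (auto intro!: DERIV_isCont simp: continuous_on_eq_continuous_at)
next
  case (Suc m)
  then show ?case by (metis ndiff.simps(2))
qed

lemma ndiff_continuous: "ndiff m f \<Longrightarrow> continuous_on UNIV f"
  by (induction m) (use ndiff_SucD in auto)

lemma ndiff_add: "ndiff m f \<Longrightarrow> ndiff m g \<Longrightarrow> ndiff m (\<lambda>x. f x + g x)"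
proof (induction m arbitrary: f g)
  case 0
  then show ?case by (auto intro: continuous_intros)
next
  case (Suc m)
  then obtain f' g' where "\<forall>x. (f has_real_derivative f' x) (at x)" "ndiff m f'"
    "\<forall>x. (g has_real_derivative g' x) (at x)" "ndiff m g'" by auto
  then show ?case using Suc.IH[of f' g'] unfolding ndiff.simps
    by (intro exI[of _ "\<lambda>x. f' x + g' x"]) (auto intro: DERIV_add)
qed

lemma ndiff_mult: "ndiff m f \<Longrightarrow> ndiff m g \<Longrightarrow> ndiff m (\<lambda>x. f x * g x)"
proof (induction m arbitrary: f g)
  case 0
  then show ?case by (auto intro: continuous_intros)
next
  case (Suc m)
  then obtain f' g' where d: "\<forall>x. (f has_real_derivative f' x) (at x)" "ndiff m f'"
    "\<forall>x. (g has_real_derivative g' x) (at x)" "ndiff m g'" by auto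
  have "ndiff m (\<lambda>x. f' x * g x + f x * g' x)"
    using ndiff_SucD[OF Suc.prems(1)] ndiff_SucD[OF Suc.prems(2)] d
    by (intro ndiff_add Suc.IH)
  moreover have "((\<lambda>x. f x * g x) has_real_derivative f' x * g x + f x * g' x) (at x)" for x
    using d DERIV_mult'[of f "f' x" x UNIV g "g' x"] by (simp add: add.commute)
  ultimately show ?case by (auto intro!: exI[of _ "\<lambda>x. f' x * g x + f x * g' x"])
qed

lemma ndiff_const: "ndiff m (\<lambda>x. c)"
proof (induction m arbitrary: c)
  case (Suc m)
  then show ?case unfolding ndiff.simps by (intro exI[of _ "\<lambda>x. 0"]) auto
qed simp

lemma ndiff_affine: "ndiff m f \<Longrightarrow> ndiff m (\<lambda>x. f (p * x + r))"
proof (induction m arbitrary: f)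
  case 0
  then have "continuous_on UNIV (f \<circ> (\<lambda>x. p * x + r))"
    by (intro continuous_on_compose) (auto intro!: continuous_intros intro: continuous_on_subset)
  then show ?case by (simp add: o_def)
next
  case (Suc m)
  then obtain f' where d: "\<And>x. (f has_real_derivative f' x) (at x)" "ndiff m f'" by auto
  have "((\<lambda>x. f (p * x + r)) has_real_derivative f' (p * x + r) * p) (at x)" for x
    by (rule DERIV_chain2[OF d(1)]) (auto intro!: derivative_eq_intros)
  moreover have "ndiff m (\<lambda>x. f' (p * x + r) * p)"
    by (rule ndiff_mult[OF Suc.IH[OF d(2)] ndiff_const])
  ultimately show ?case by (auto intro!: exI[of _ "\<lambda>x. f' (p * x + r) * p"])
qed

text \<open>
  The functions \<open>P (1/t) exp (-1/t)\<close>, extended by zero to \<open>t \<le> 0\<close>, form a class that is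
  closed under differentiation.
\<close>

definition flat :: "real poly \<Rightarrow> real \<Rightarrow> real" where
  "flat P t = (if t > 0 then poly P (1 / t) * exp (- (1 / t)) else 0)"

lemma poly_mult_exp_tendsto_0: "((\<lambda>y::real. poly P y * exp (- y)) \<longlongrightarrow> 0) at_top"
proof -
  have "((\<lambda>y::real. y ^ k * exp (- y)) \<longlongrightarrow> 0) at_top" for k
    using tendsto_power_div_exp_0[of k] by (simp add: exp_minus field_simps)
  then have "((\<lambda>y. \<Sum>i\<le>degree P. coeff P i * (y ^ i * exp (- y))) \<longlongrightarrow> (\<Sum>i\<le>degree P. coeff P i * 0)) at_top"
    by (intro tendsto_sum tendsto_mult tendsto_const)
  then show ?thesis by (simp add: poly_altdef sum_distrib_right mult.assoc)
qed

lemma flat_deriv: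
  "(flat P has_real_derivative flat ([:0, 0, 1:] * (P - pderiv P)) t) (at t)"
proof (cases t "0::real" rule: linorder_cases)
  case less
  have "((\<lambda>t. 0) has_real_derivative flat ([:0, 0, 1:] * (P - pderiv P)) t) (at t)"
    using less by (auto simp: flat_def)
  moreover have "eventually (\<lambda>s. flat P s = 0) (nhds t)"
    using eventually_nhds_in_open[of "{..<0}" t] less by (auto elim!: eventually_mono simp: flat_def)
  ultimately show ?thesis by (subst DERIV_cong_ev[OF refl _ refl]) auto
next
  case greater
  have "((\<lambda>t. poly P (1 / t) * exp (- (1 / t))) has_real_derivative
     flat ([:0, 0, 1:] * (P - pderiv P)) t) (at t)"
    using greater by (auto intro!: derivative_eq_intros simp: flat_def field_simps power2_eq_square)
  moreover have "eventually (\<lambda>s. flat P s = poly P (1 / s) * exp (- (1 / s))) (nhds t)"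
    using eventually_nhds_in_open[of "{0<..}" t] greater by (auto elim!: eventually_mono simp: flat_def)
  ultimately show ?thesis by (subst DERIV_cong_ev[OF refl _ refl]) auto
next
  case equal
  \<comment> \<open>The difference quotient at 0 from the right is again a polynomial in \<open>1/h\<close> times
    \<open>exp (-1/h)\<close>.\<close>
  have R: "((\<lambda>h. flat P h / h) \<longlongrightarrow> 0) (at_right 0)"
  proof -
    have "((\<lambda>h::real. poly ([:0, 1:] * P) (inverse h) * exp (- (inverse h))) \<longlongrightarrow> 0) (at_right 0)"
      using filterlim_compose[OF poly_mult_exp_tendsto_0 filterlim_inverse_at_top_right] .
    then show ?thesis
      by (rule Lim_transform_eventually)
         (auto simp: flat_def eventually_at_filter field_simps inverse_eq_divide)
  qed
  have L: "((\<lambda>h. flat P h / h) \<longlongrightarrow> 0) (at_left 0)"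
    by (rule Lim_transform_eventually[OF tendsto_const]) (auto simp: flat_def eventually_at_filter)
  have "((\<lambda>h. flat P h / h) \<longlongrightarrow> 0) (at 0)" using L R by (simp add: filterlim_split_at)
  then show ?thesis unfolding equal DERIV_def by (simp add: flat_def)
qed

lemma ndiff_flat: "ndiff m (flat P)"
proof (induction m arbitrary: P)
  case 0
  then show ?case by (auto intro!: DERIV_isCont[OF flat_deriv] simp: continuous_on_eq_continuous_at)
next
  case (Suc m)
  show ?case using flat_deriv Suc.IH
    by (auto simp del: mult_pCons_left intro!: exI[of _ "flat ([:0, 0, 1:] * (P - pderiv P))"])
qed

text \<open>
  For fixed \<open>c\<close> and \<open>d\<close> these functions, with values between 0 and 1, converge pointwise to the
  indicator function of the open interval from \<open>c\<close> to \<open>d\<close>. The shift by 1 makes each of them vanish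
  outside a compact subset of that interval.
\<close>

definition bump :: "nat \<Rightarrow> real \<Rightarrow> real \<Rightarrow> real \<Rightarrow> real" where
  "bump n c d t = flat 1 (real n * (t - c) - 1) * flat 1 (real n * (d - t) - 1)"

lemma ndiff_bump: "ndiff m (bump n c d)"
proof -
  have "ndiff m (\<lambda>t. flat 1 (real n * t + (- real n * c - 1)) * flat 1 ((- real n) * t + (real n * d - 1)))"
    by (intro ndiff_mult ndiff_affine ndiff_flat)
  then show ?thesis unfolding bump_def[abs_def] by (simp add: algebra_simps)
qed

lemma flat_1_bounds: "0 \<le> flat 1 t" "flat 1 t \<le> 1"
  by (auto simp: flat_def)

lemma bump_bounds: "0 \<le> bump n c d t" "bump n c d t \<le> 1"
  by (auto simp: bump_def flat_1_bounds mult_le_one)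

lemma bump_eq_0:
  assumes "t \<notin> {c + 1 / real (Suc n) .. d - 1 / real (Suc n)}"
  shows "bump (Suc n) c d t = 0"
proof -
  have "real (Suc n) * (t - c) - 1 \<le> 0 \<or> real (Suc n) * (d - t) - 1 \<le> 0"
  proof (cases "t < c + 1 / real (Suc n)")
    case True
    then have "real (Suc n) * (t - c) \<le> real (Suc n) * (1 / real (Suc n))" by (intro mult_left_mono) auto
    then show ?thesis by simp
  next
    case False
    then have "t > d - 1 / real (Suc n)" using assms by auto
    then have "real (Suc n) * (d - t) \<le> real (Suc n) * (1 / real (Suc n))" by (intro mult_left_mono) auto
    then show ?thesis by simp
  qed
  then show ?thesis by (auto simp: bump_def flat_def simp del: of_nat_Suc)
qed

lemma flat_1_tendsto:
  assumes "r > 0"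
  shows "(\<lambda>n. flat 1 (real n * r - 1)) \<longlonglongrightarrow> 1"
proof -
  have lim: "filterlim (\<lambda>n. -1 + real n * r) at_top sequentially"
    by (intro filterlim_tendsto_add_at_top[OF tendsto_const]
        filterlim_at_top_mult_tendsto_pos[OF tendsto_const assms] filterlim_real_sequentially)
  have "eventually (\<lambda>n. -1 + real n * r > 0) sequentially"
    using lim unfolding filterlim_at_top_dense by blast
  then have ev: "eventually (\<lambda>n. exp (- (1 / (real n * r - 1))) = flat 1 (real n * r - 1)) sequentially"
    by eventually_elim (simp add: flat_def)
  have "(\<lambda>n. exp (- (1 / (-1 + real n * r)))) \<longlonglongrightarrow> exp (- 0)"
    by (intro tendsto_exp tendsto_minus tendsto_divide_0[OF tendsto_const] filterlim_at_top_imp_at_infinity lim)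
  then have "(\<lambda>n. exp (- (1 / (real n * r - 1)))) \<longlonglongrightarrow> 1" by (simp add: algebra_simps)
  then show ?thesis using Lim_transform_eventually[OF _ ev] by simp
qed

lemma bump_tendsto: "(\<lambda>n. bump (Suc n) c d t) \<longlonglongrightarrow> indicator {c<..<d} t"
proof (cases "t \<in> {c<..<d}")
  case True
  have "(\<lambda>n. bump n c d t) \<longlonglongrightarrow> 1 * 1"
    unfolding bump_def using True by (intro tendsto_mult flat_1_tendsto) auto
  then show ?thesis using True LIMSEQ_Suc by fastforce
next
  case False
  have "bump (Suc n) c d t = 0" for n
  proof (rule bump_eq_0)
    have "1 / real (Suc n) > 0" by simp
    moreover have "t \<le> c \<or> d \<le> t" using False by auto
    ultimately show "t \<notin> {c + 1 / real (Suc n)..d - 1 / real (Suc n)}"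
      unfolding atLeastAtMost_iff by linarith
  qed
  then show ?thesis using False by simp
qed

section \<open>Products of functions of one coordinate as test functions\<close>

text \<open>
  The function \<open>x \<mapsto> \<Prod>\<^sub>i h\<^sub>i(x\<^sub>i)\<close>. Its partial derivatives are products of the same kind.
\<close>

definition coord_prod :: "('n \<Rightarrow> real \<Rightarrow> real) \<Rightarrow> real^'n \<Rightarrow> real" where
  "coord_prod h x = (\<Prod>i\<in>UNIV. h i (x $ i))"

lemma coord_prod_upd:
  "coord_prod (h(j := f)) x = f (x $ j) * (\<Prod>i\<in>UNIV - {j}. h i (x $ i))"
  unfolding coord_prod_def by (subst prod.remove[of _ j]) auto

lemma continuous_coord_prod:
  assumes "\<And>i. continuous_on UNIV (h i)"
  shows "continuous_on UNIV (coord_prod h)"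
  unfolding coord_prod_def
  by (intro continuous_on_prod continuous_on_compose2[OF assms]) (auto intro!: continuous_intros)

lemma coord_prod_partial:
  assumes "\<And>t. (h j has_real_derivative f t) (at t)"
  shows "((\<lambda>t. coord_prod h (x + t *\<^sub>R axis j 1)) has_real_derivative coord_prod (h(j := f)) x) (at 0)"
proof -
  have eq: "coord_prod h (x + t *\<^sub>R axis j 1) = h j (x $ j + t) * (\<Prod>i\<in>UNIV - {j}. h i (x $ i))" for t
  proof -
    have "coord_prod (h(j := h j)) (x + t *\<^sub>R axis j 1) = h j (x $ j + t) * (\<Prod>i\<in>UNIV - {j}. h i (x $ i))"
      unfolding coord_prod_upd by (auto intro!: arg_cong2[where f="(*)"] prod.cong simp: axis_def)
    then show ?thesis by simp
  qed
  have "((\<lambda>t. h j (x $ j + t)) has_real_derivative f (x $ j + 0) * 1) (at 0)"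
    by (rule DERIV_chain2[OF assms]) (auto intro!: derivative_eq_intros)
  from DERIV_cmult_right[OF this] show ?thesis unfolding eq coord_prod_upd by simp
qed

lemma pderivative_coord_prod:
  assumes "\<And>t. (h j has_real_derivative f t) (at t)"
  shows "pderivative j (coord_prod h) = coord_prod (h(j := f))"
  unfolding pderivative_def using DERIV_imp_deriv[OF coord_prod_partial[of h j f]] assms by blast

lemma C_k_coord_prod:
  assumes "\<And>i. ndiff m (h i)"
  shows "C_k m (coord_prod h)"
  using assms
proof (induction m arbitrary: h)
  case 0
  then show ?case by (auto intro: continuous_coord_prod)
next
  case (Suc m)
  have "continuous_on UNIV (coord_prod h)"
    using Suc.prems ndiff_continuous by (intro continuous_coord_prod) blast
  moreover have "(\<lambda>t. coord_prod h (x + t *\<^sub>R axis j 1)) field_differentiable at 0 \<and>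
      C_k m (pderivative j (coord_prod h))" for j x
  proof -
    obtain f where f: "\<And>t. (h j has_real_derivative f t) (at t)" "ndiff m f"
      using Suc.prems[of j] by auto
    have "C_k m (coord_prod (h(j := f)))"
      using f Suc.prems ndiff_SucD by (intro Suc.IH) auto
    then show ?thesis
      using coord_prod_partial[of h j f, OF f(1)] pderivative_coord_prod[of h j f, OF f(1)]
      unfolding field_differentiable_def by auto
  qed
  ultimately show ?case by simp
qed

lemma coord_prod_test_function:
  fixes h :: "'n::finite \<Rightarrow> real \<Rightarrow> real" and a b :: "real^'n"
  assumes "\<And>m i. ndiff m (h i)" and "\<And>i t. t \<notin> {c $ i..d $ i} \<Longrightarrow> h i t = 0"
    and "\<And>i. a $ i < c $ i" "\<And>i. d $ i < b $ i"
  shows "coord_prod h \<in> test_functions (box a b)"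
proof -
  have "{x. coord_prod h x \<noteq> 0} \<subseteq> cbox c d"
  proof
    fix x assume "x \<in> {x. coord_prod h x \<noteq> 0}"
    then have "h i (x $ i) \<noteq> 0" for i by (auto simp: coord_prod_def)
    then show "x \<in> cbox c d" using assms(2) unfolding mem_box_cart by (meson atLeastAtMost_iff)
  qed
  then have "closure {x. coord_prod h x \<noteq> 0} \<subseteq> cbox c d" by (rule closure_minimal) (rule closed_cbox)
  moreover have "cbox c d \<subseteq> box a b"
    unfolding subset_iff mem_box_cart using assms(3,4) by (meson less_le_trans le_less_trans)
  ultimately show ?thesis
    unfolding test_functions_def
    using C_k_coord_prod[OF assms(1)] compact_Int_closed[OF compact_cbox[of c d] closed_closure[of "{x. coord_prod h x \<noteq> 0}"]]
    by (auto simp: Int_absorb1)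
qed

section \<open>The fundamental lemma of the calculus of variations\<close>

text \<open>
  Bump functions for boxes, converging pointwise to the indicator function of the open box.
\<close>

definition bump_prod :: "nat \<Rightarrow> real^'n \<Rightarrow> real^'n \<Rightarrow> real^'n \<Rightarrow> real" where
  "bump_prod n c d = coord_prod (\<lambda>i. bump n (c $ i) (d $ i))"

lemma bump_prod_bounds: "0 \<le> bump_prod n c d x" "bump_prod n c d x \<le> 1"
  unfolding bump_prod_def coord_prod_def by (auto intro!: prod_nonneg prod_le_1 simp: bump_bounds)

lemma continuous_bump_prod: "continuous_on UNIV (bump_prod n c d)"
  unfolding bump_prod_def by (intro continuous_coord_prod ndiff_continuous[OF ndiff_bump])

lemma indicator_box_eq_prod:
  fixes c d x :: "real^'n"
  shows "(indicator (box c d) x :: real) = (\<Prod>i\<in>UNIV. indicator {c $ i<..<d $ i} (x $ i))"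
proof (cases "x \<in> box c d")
  case True
  then have "indicator {c $ i<..<d $ i} (x $ i) = (1::real)" for i unfolding mem_box_cart by simp
  then show ?thesis using True by simp
next
  case False
  then obtain i where "x $ i \<notin> {c $ i<..<d $ i}" by (auto simp: mem_box_cart)
  then have "indicator {c $ i<..<d $ i} (x $ i) = (0::real)" by simp
  then have "(\<Prod>i\<in>UNIV. indicator {c $ i<..<d $ i} (x $ i)) = (0::real)"
    by (intro prod_zero finite) blast
  then show ?thesis using False by simp
qed

lemma bump_prod_tendsto:
  "(\<lambda>n. bump_prod (Suc n) c d x) \<longlonglongrightarrow> indicator (box c d) x"
  unfolding indicator_box_eq_prod bump_prod_def coord_prod_def
  by (intro tendsto_prod bump_tendsto)

lemma bump_prod_eq_0: "x \<notin> box c d \<Longrightarrow> bump_prod (Suc n) c d x = 0"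
proof -
  assume "x \<notin> box c d"
  then obtain i where "x $ i \<notin> {c $ i<..<d $ i}" by (auto simp: mem_box_cart)
  moreover have "1 / real (Suc n) > 0" by simp
  ultimately have "x $ i \<notin> {c $ i + 1 / real (Suc n)..d $ i - 1 / real (Suc n)}"
    unfolding atLeastAtMost_iff greaterThanLessThan_iff by linarith
  then have "bump (Suc n) (c $ i) (d $ i) (x $ i) = 0" by (rule bump_eq_0)
  then show ?thesis unfolding bump_prod_def coord_prod_def
    by (intro prod_zero) (auto intro!: bexI[of _ i])
qed

lemma bump_prod_test_function:
  fixes a b c d :: "real^'n"
  assumes "\<And>i. a $ i \<le> c $ i" "\<And>i. d $ i \<le> b $ i"
  shows "bump_prod (Suc n) c d \<in> test_functions (box a b)"
proof -
  have pos: "1 / real (Suc n) > 0" by simp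
  have "a $ i < (\<chi> j. c $ j + 1 / real (Suc n)) $ i" for i
    using assms(1)[of i] pos unfolding vec_lambda_beta by linarith
  moreover have "(\<chi> j. d $ j - 1 / real (Suc n)) $ i < b $ i" for i
    using assms(2)[of i] pos unfolding vec_lambda_beta by linarith
  ultimately show ?thesis
    unfolding bump_prod_def
    by (rule coord_prod_test_function[OF ndiff_bump, rotated]) (use bump_eq_0 in auto)
qed

text \<open>
  The open boxes are stable under intersection and generate the Borel sets, and a Lebesgue
  measurable set differs from a Borel set by a null set, so the integral of \<open>f\<close> over every
  measurable set vanishes.
\<close>

lemma AE_zero_if_box_integrals_zero:
  fixes f :: "real^'n \<Rightarrow> 'b::{banach, second_countable_topology}"
  assumes int: "integrable (lebesgue_on (box a b)) f"
    and z: "\<And>c d. (LINT x|lebesgue_on (box a b). indicator (box c d) x *\<^sub>R f x) = 0"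
  shows "AE x in lebesgue_on (box a b). f x = 0"
proof -
  let ?S = "box a b" let ?M = "lebesgue_on ?S"
  define F where "F x = indicator ?S x *\<^sub>R f x" for x
  have F: "integrable lebesgue F"
    using int unfolding F_def by (simp add: integrable_restrict_space)
  have conv: "(LINT x|?M. indicator A x *\<^sub>R f x) = (LINT x:A|lebesgue. F x)" for A
    by (simp add: integral_restrict_space set_lebesgue_integral_def F_def mult.commute)
  have FA: "set_integrable lebesgue A F" if "A \<in> sets borel" for A
    unfolding set_integrable_def using that F by (intro integrable_mult_indicator) auto
  have borel: "(LINT x:A|lebesgue. F x) = 0" if "A \<in> sets borel" for A
  proof -
    let ?G = "range (\<lambda>(a, b). box a b :: (real^'n) set)"
    have st: "sigma_sets UNIV ?G = sets borel" by (subst borel_eq_box) simp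
    have "Int_stable ?G"
    proof (rule Int_stableI)
      fix A B assume "A \<in> ?G" "B \<in> ?G"
      then obtain p q r s where "A = box p q" "B = box r s" by auto
      then have "A \<inter> B = box (\<chi> i. max (p $ i) (r $ i)) (\<chi> i. min (q $ i) (s $ i))"
        by (auto simp: mem_box_cart)
      then show "A \<inter> B \<in> ?G" by auto
    qed
    moreover have "?G \<subseteq> Pow UNIV" by simp
    moreover have "A \<in> sigma_sets UNIV ?G" using that st by simp
    ultimately show ?thesis
    proof (induction rule: sigma_sets_induct_disjoint)
      case (basic A)
      then obtain p q where "A = box p q" by auto
      then show ?case using z[of p q] conv[of A] by simp
    next
      case empty
      then show ?case by (simp add: set_lebesgue_integral_def)
    next
      case (compl A)
      have "A \<in> sets borel" using compl st by simp
      then have "(LINT x:UNIV|lebesgue. F x) = (LINT x:A|lebesgue. F x) + (LINT x:UNIV - A|lebesgue. F x)"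
        using set_integral_Un[of A "UNIV - A" lebesgue F] FA[of A] FA[of "UNIV - A"] by auto
      moreover have "(LINT x:UNIV|lebesgue. F x) = (LINT x:?S|lebesgue. F x)"
        unfolding set_lebesgue_integral_def F_def
        by (intro Bochner_Integration.integral_cong) (auto simp: indicator_def)
      moreover have "\<dots> = 0" using z[of a b] conv[of ?S] by simp
      ultimately show ?case using compl by simp
    next
      case (union A)
      have "A i \<in> sets lebesgue" for i using union(2) st by auto
      moreover have "(\<Union>i. A i) \<in> sets borel" using union(2) st by auto
      ultimately have "(LINT x:(\<Union>i. A i)|lebesgue. F x) = (\<Sum>i. (LINT x:A i|lebesgue. F x))"
        using union(1) by (intro lebesgue_integral_countable_add FA) (auto simp: disjoint_family_on_def)
      then show ?case using union(3) by simp
    qed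
  qed
  interpret finite_measure ?M by (rule finite_measure_lebesgue_on) auto
  show ?thesis
  proof (rule density_zero[OF int])
    fix A assume "A \<in> sets ?M"
    then have A: "A \<in> sets lebesgue" by (auto simp: sets_restrict_space)
    then obtain B N N' where N: "A = B \<union> N" "N \<subseteq> N'" "N' \<in> null_sets lborel" "B \<in> sets lborel"
      by (rule sets_completionE)
    have "AE x in lebesgue. x \<notin> N'"
      using N(3) by (intro AE_completion AE_not_in)
    then have ae: "AE x in lebesgue. indicator A x *\<^sub>R F x = indicator B x *\<^sub>R F x"
      by eventually_elim (use N in \<open>auto simp: indicator_def\<close>)
    have m: "F \<in> borel_measurable lebesgue" using F by simp
    have mA: "(\<lambda>x. indicator C x *\<^sub>R F x) \<in> borel_measurable lebesgue" if "C \<in> sets lebesgue" for C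
      using that m by (intro borel_measurable_scaleR borel_measurable_indicator) auto
    have "(LINT x:A|?M. f x) = (LINT x:A|lebesgue. F x)"
      using conv[of A] by (simp add: set_lebesgue_integral_def)
    also have "\<dots> = (LINT x:B|lebesgue. F x)"
      unfolding set_lebesgue_integral_def using ae A N(4) by (intro integral_cong_AE mA) auto
    also have "\<dots> = 0" using borel N(4) by simp
    finally show "(LINT x:A|?M. f x) = 0" .
  qed
qed

lemma AE_zero_if_bump_integrals_zero:
  fixes f :: "real^'n \<Rightarrow> 'b::{banach, second_countable_topology}"
  assumes int: "integrable (lebesgue_on (box a b)) f"
    and z: "\<And>c d n. (\<And>i. a $ i \<le> c $ i) \<Longrightarrow> (\<And>i. d $ i \<le> b $ i) \<Longrightarrow>
      (LINT x|lebesgue_on (box a b). bump_prod (Suc n) c d x *\<^sub>R f x) = 0"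
  shows "AE x in lebesgue_on (box a b). f x = 0"
proof (rule AE_zero_if_box_integrals_zero[OF int])
  fix c d
  let ?M = "lebesgue_on (box a b)"
  \<comment> \<open>Only the part of the box from \<open>c\<close> to \<open>d\<close> inside the domain matters, and there the bump
    functions are test functions.\<close>
  define c' where "c' = (\<chi> i. max (a $ i) (c $ i))"
  define d' where "d' = (\<chi> i. min (b $ i) (d $ i))"
  have m: "f \<in> borel_measurable ?M" using int by simp
  have sub: "box c' d' \<subseteq> box a b" unfolding subset_iff mem_box_cart c'_def d'_def by simp
  have "(\<lambda>n. LINT x|?M. bump_prod (Suc n) c' d' x *\<^sub>R f x) \<longlonglongrightarrow>
        (LINT x|?M. indicator (box c' d') x *\<^sub>R f x)"
  proof (rule integral_dominated_convergence[where w="\<lambda>x. norm (f x)"])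
    show "(\<lambda>x. indicator (box c' d') x *\<^sub>R f x) \<in> borel_measurable ?M"
      using m sub by (intro borel_measurable_scaleR borel_measurable_indicator)
        (auto simp: sets_restrict_space_iff)
    show "(\<lambda>x. bump_prod (Suc n) c' d' x *\<^sub>R f x) \<in> borel_measurable ?M" for n
      by (intro borel_measurable_scaleR m continuous_imp_measurable_on_sets_lebesgue
          continuous_on_subset[OF continuous_bump_prod]) auto
    show "integrable ?M (\<lambda>x. norm (f x))" using int by simp
    show "AE x in ?M. (\<lambda>n. bump_prod (Suc n) c' d' x *\<^sub>R f x) \<longlonglongrightarrow> indicator (box c' d') x *\<^sub>R f x"
      by (intro AE_I2 tendsto_scaleR bump_prod_tendsto tendsto_const)
    show "AE x in ?M. norm (bump_prod (Suc n) c' d' x *\<^sub>R f x) \<le> norm (f x)" for n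
      using bump_prod_bounds[of "Suc n" c' d'] by (intro AE_I2) (auto intro!: mult_left_le_one_le)
  qed
  moreover have "(LINT x|?M. bump_prod (Suc n) c' d' x *\<^sub>R f x) = 0" for n
    by (intro z) (auto simp: c'_def d'_def)
  ultimately have "(LINT x|?M. indicator (box c' d') x *\<^sub>R f x) = 0"
    by (simp add: LIMSEQ_const_iff)
  moreover have "(LINT x|?M. indicator (box c d) x *\<^sub>R f x) = (LINT x|?M. indicator (box c' d') x *\<^sub>R f x)"
    by (intro Bochner_Integration.integral_cong) (auto simp: c'_def d'_def mem_box_cart indicator_def)
  ultimately show "(LINT x|?M. indicator (box c d) x *\<^sub>R f x) = 0" by simp
qed

lemma fundamental_lemma:
  fixes f :: "real^'n \<Rightarrow> 'b::{banach, second_countable_topology}"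
  assumes "integrable (lebesgue_on (box a b)) f"
    and "\<And>\<theta>. \<theta> \<in> test_functions (box a b) \<Longrightarrow> (LINT x|lebesgue_on (box a b). \<theta> x *\<^sub>R f x) = 0"
  shows "AE x in lebesgue_on (box a b). f x = 0"
  by (rule AE_zero_if_bump_integrals_zero[OF assms(1)]) (rule assms(2)[OF bump_prod_test_function])

section \<open>Functions with vanishing weak gradient\<close>

lemma continuous_integrable_box:
  fixes f :: "real^'n \<Rightarrow> 'b::euclidean_space"
  assumes "continuous_on UNIV f"
  shows "integrable (lebesgue_on (box a b)) f"
proof -
  have "integrable (lebesgue_on (cbox a b)) f"
    by (rule continuous_imp_integrable) (rule continuous_on_subset[OF assms], simp)
  then have "integrable lebesgue (\<lambda>x. indicator (box a b) x *\<^sub>R (indicator (cbox a b) x *\<^sub>R f x))"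
    by (intro integrable_mult_indicator[of "box a b"]) (simp_all add: integrable_restrict_space)
  moreover have "(\<lambda>x. indicator (box a b) x *\<^sub>R (indicator (cbox a b) x *\<^sub>R f x)) = (\<lambda>x. indicator (box a b) x *\<^sub>R f x)"
    using box_subset_cbox[of a b] by (auto simp: indicator_def fun_eq_iff)
  ultimately have "integrable lebesgue (\<lambda>x. indicator (box a b) x *\<^sub>R f x)" by (simp only:)
  then show ?thesis by (simp add: integrable_restrict_space)
qed

lemma continuous_AE_zero:
  fixes f :: "real^'n \<Rightarrow> 'b::real_normed_vector"
  assumes "continuous_on UNIV f" "open S" "AE x in lebesgue_on S. f x = 0" "x \<in> S"
  shows "f x = 0"
proof (rule ccontr)
  assume "f x \<noteq> 0"
  define T where "T = S \<inter> f -` (- {0})"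
  have "open T" unfolding T_def
    using assms(1,2) by (intro open_Int) (auto intro!: continuous_open_vimage simp: continuous_on_eq_continuous_at)
  moreover have "x \<in> T" using assms(4) \<open>f x \<noteq> 0\<close> by (simp add: T_def)
  ultimately have "\<not> negligible T" using open_not_negligible by blast
  moreover have "S \<in> sets lebesgue" using assms(2) by simp
  then have "AE x in lebesgue. x \<in> S \<longrightarrow> f x = 0"
    using assms(3) by (simp add: AE_restrict_space_iff)
  then have "AE x in lebesgue. x \<notin> T" by eventually_elim (auto simp: T_def)
  then have "T \<in> null_sets lebesgue" using \<open>open T\<close> by (simp add: AE_iff_null_sets)
  ultimately show False by (simp add: negligible_iff_null_sets)
qed

lemma lebesgue_on_integral_lborel:
  fixes f :: "real^'n \<Rightarrow> 'b::euclidean_space"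
  assumes "continuous_on UNIV f" "\<And>x. x \<notin> S \<Longrightarrow> f x = 0" "open S"
  shows "(LINT x|lebesgue_on S. f x) = (LINT x|lborel. f x)"
proof -
  have "(LINT x|lebesgue_on S. f x) = (LINT x|lebesgue. indicator S x *\<^sub>R f x)"
    using assms(3) by (intro integral_restrict_space) auto
  also have "(\<lambda>x. indicator S x *\<^sub>R f x) = f"
    using assms(2) by (auto simp: indicator_def fun_eq_iff)
  also have "(LINT x|lebesgue. f x) = (LINT x|lborel. f x)"
    using assms(1) by (intro integral_completion) (simp add: borel_measurable_continuous_onI)
  finally show ?thesis .
qed

lemma lborel_integral_translate:
  fixes f :: "real^'n \<Rightarrow> 'b::euclidean_space"
  assumes "continuous_on UNIV f"
  shows "(LINT x|lborel. f (v + x)) = (LINT x|lborel. f x)"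
proof -
  have "(LINT x|lborel. f x) = (LINT x|distr lborel borel ((+) v). f x)" by (simp add: lborel_distr_plus)
  also have "\<dots> = (LINT x|lborel. f (v + x))"
    using assms by (intro integral_distr) (auto intro: borel_measurable_continuous_onI)
  finally show ?thesis ..
qed

lemma integrable_continuous_outside_box:
  fixes f :: "real^'n \<Rightarrow> 'b::euclidean_space"
  assumes "continuous_on UNIV f" "\<And>x. x \<notin> box c d \<Longrightarrow> f x = 0"
  shows "integrable lborel f"
proof -
  have "integrable lborel (\<lambda>x. indicator (cbox c d) x *\<^sub>R f x)"
    by (rule borel_integrable_compact[OF compact_cbox]) (rule continuous_on_subset[OF assms(1)], simp)
  moreover have "(\<lambda>x. indicator (cbox c d) x *\<^sub>R f x) = f"
    using assms(2) box_subset_cbox[of c d] by (auto simp: indicator_def fun_eq_iff)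
  ultimately show ?thesis by simp
qed

text \<open>
  The difference of a bump function and its translate along a coordinate axis is a partial
  derivative of a test function.
\<close>

lemma bump_difference_antiderivative:
  assumes "s > 0"
  obtains H where "\<And>m. ndiff m H"
    "\<And>t. (H has_real_derivative bump (Suc n) c d (t - s) - bump (Suc n) c d t) (at t)"
    "\<And>t. t \<notin> {c + 1 / real (Suc n)..d + s - 1 / real (Suc n)} \<Longrightarrow> H t = 0"
proof -
  let ?g = "bump (Suc n) c d"
  have "\<exists>F. \<forall>x::real. -\<infinity> < ereal x \<longrightarrow> ereal x < \<infinity> \<longrightarrow> (F has_vector_derivative ?g x) (at x)"
    using ndiff_continuous[OF ndiff_bump]
    by (intro einterval_antiderivative) (auto simp: continuous_on_eq_continuous_at)
  then obtain F where F: "\<And>x. (F has_real_derivative ?g x) (at x)"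
    by (auto simp: has_real_derivative_iff_has_vector_derivative)
  define H where "H t = F (t - s) - F t" for t
  have H: "(H has_real_derivative ?g (t - s) - ?g t) (at t)" for t
  proof -
    have "((\<lambda>t. F (t - s)) has_real_derivative ?g (t - s) * 1) (at t)"
      by (rule DERIV_chain2[OF F]) (auto intro!: derivative_eq_intros)
    from DERIV_diff[OF this F[of t]] show ?thesis unfolding H_def[abs_def] by simp
  qed
  have "ndiff m (\<lambda>t. ?g (t - s) - ?g t)" for m
  proof -
    have "ndiff m (\<lambda>t. ?g (1 * t + - s) + (-1) * ?g t)"
      by (intro ndiff_add ndiff_mult ndiff_const ndiff_affine ndiff_bump)
    then show ?thesis by simp
  qed
  then have "ndiff (Suc m) H" for m
    using H by (auto intro!: exI[of _ "\<lambda>t. ?g (t - s) - ?g t"])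
  then have "ndiff m H" for m by (rule ndiff_SucD)
  moreover have "H t = 0" if t: "t \<notin> {c + 1 / real (Suc n)..d + s - 1 / real (Suc n)}" for t
  proof -
    have "F (t - s) = F t"
    proof (rule DERIV_isconst_end[where f=F and a="t - s" and b=t, symmetric])
      show "t - s < t" using assms by simp
      show "continuous_on {t - s..t} F" by (auto intro!: continuous_at_imp_continuous_on DERIV_isCont[OF F])
      fix x assume "t - s < x" "x < t"
      then have "x \<notin> {c + 1 / real (Suc n)..d - 1 / real (Suc n)}" using t assms by auto
      then have "?g x = 0" by (rule bump_eq_0)
      then show "DERIV F x :> 0" using F[of x] by simp
    qed
    then show ?thesis by (simp add: H_def)
  qed
  ultimately show thesis using that H by blast
qed

text \<open>
  By the preceding lemma, the integral of \<open>u\<close> against a bump function does not change when the bump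
  function is translated inside the box; equivalently, the integrals of \<open>u(x + s e\<^sub>i) - u(x)\<close> against
  bump functions vanish.
\<close>

lemma zero_weak_gradient_imp_translation_invariant:
  fixes u :: "real^'n \<Rightarrow> 'b::euclidean_space" and a b :: "real^'n"
  assumes u: "continuous_on UNIV u"
    and z: "\<And>\<theta>. \<theta> \<in> test_functions (box a b) \<Longrightarrow>
      (LINT x|lebesgue_on (box a b). pderivative i \<theta> x *\<^sub>R u x) = 0"
    and s: "s > 0" and x: "x \<in> box a b" "x + s *\<^sub>R axis i 1 \<in> box a b"
  shows "u (x + s *\<^sub>R axis i 1) = u x"
proof -
  let ?e = "s *\<^sub>R axis i 1 :: real^'n"
  define b' where "b' = b - ?e"
  define f where "f y = u (y + ?e) - u y" for y
  have ut: "continuous_on UNIV (\<lambda>y. u (y + v))" for v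
    by (rule continuous_on_compose2[OF u]) (auto intro!: continuous_intros)
  have f: "continuous_on UNIV f" unfolding f_def by (intro continuous_intros ut u)
  have b': "b' $ j \<le> b $ j" for j using s by (simp add: b'_def axis_def)
  have "AE y in lebesgue_on (box a b'). f y = 0"
  proof (rule AE_zero_if_bump_integrals_zero)
    show "integrable (lebesgue_on (box a b')) f" using f by (rule continuous_integrable_box)
    fix c d n assume c: "\<And>i. a $ i \<le> c $ i" and d: "\<And>i. d $ i \<le> b' $ i"
    let ?p = "bump_prod (Suc n) c d"
    have pc: "continuous_on UNIV ?p" by (rule continuous_bump_prod)
    have pt: "continuous_on UNIV (\<lambda>y. ?p (y - ?e))"
      by (rule continuous_on_compose2[OF pc]) (auto intro!: continuous_intros)
    obtain H where H: "\<And>m. ndiff m H"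
      "\<And>t. (H has_real_derivative bump (Suc n) (c $ i) (d $ i) (t - s) - bump (Suc n) (c $ i) (d $ i) t) (at t)"
      "\<And>t. t \<notin> {c $ i + 1 / real (Suc n)..d $ i + s - 1 / real (Suc n)} \<Longrightarrow> H t = 0"
      using bump_difference_antiderivative[OF s] by blast
    define h where "h = (\<lambda>j. bump (Suc n) (c $ j) (d $ j))"
    define \<theta> where "\<theta> = coord_prod (h(i := H))"
    have pos: "1 / real (Suc n) > 0" by simp
    have "\<theta> \<in> test_functions (box a b)" unfolding \<theta>_def
    proof (rule coord_prod_test_function[where c="\<chi> j. c $ j + 1 / real (Suc n)"
          and d="\<chi> j. (d + ?e) $ j - 1 / real (Suc n)"])
      show "ndiff m ((h(i := H)) j)" for m j using H(1) ndiff_bump by (auto simp: h_def)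
      show "(h(i := H)) j t = 0"
        if "t \<notin> {(\<chi> j. c $ j + 1 / real (Suc n)) $ j..(\<chi> j. (d + ?e) $ j - 1 / real (Suc n)) $ j}" for j t
        using that H(3)[of t] bump_eq_0[of t "c $ j" n "d $ j"]
        by (cases "j = i") (auto simp: h_def axis_def simp del: of_nat_Suc)
      show "a $ j < (\<chi> j. c $ j + 1 / real (Suc n)) $ j" for j
        using c[of j] pos unfolding vec_lambda_beta by linarith
      show "(\<chi> j. (d + ?e) $ j - 1 / real (Suc n)) $ j < b $ j" for j
      proof -
        have "(d + ?e) $ j \<le> b $ j" using d[of j] by (simp add: b'_def)
        then show ?thesis using pos unfolding vec_lambda_beta by linarith
      qed
    qed
    then have "(LINT y|lebesgue_on (box a b). pderivative i \<theta> y *\<^sub>R u y) = 0" by (rule z)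
    moreover have "pderivative i \<theta> y = ?p (y - ?e) - ?p y" for y
    proof -
      have "pderivative i \<theta> = coord_prod ((h(i := H))(i := \<lambda>t. h i (t - s) - h i t))"
        unfolding \<theta>_def by (rule pderivative_coord_prod) (use H(2) in \<open>simp add: h_def\<close>)
      then have "pderivative i \<theta> y = coord_prod ((h(i := H))(i := \<lambda>t. h i (t - s) - h i t)) y" by simp
      also have "\<dots> = (h i (y $ i - s) - h i (y $ i)) * (\<Prod>j\<in>UNIV - {i}. h j (y $ j))"
        using coord_prod_upd[of h i] by simp
      finally have 1: "pderivative i \<theta> y = h i (y $ i - s) * (\<Prod>j\<in>UNIV - {i}. h j (y $ j))
          - h i (y $ i) * (\<Prod>j\<in>UNIV - {i}. h j (y $ j))" by (simp add: algebra_simps)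
      have 2: "?p y = h i (y $ i) * (\<Prod>j\<in>UNIV - {i}. h j (y $ j))" for y
        using coord_prod_upd[of h i "h i" y] unfolding bump_prod_def h_def[symmetric] by simp
      have "(\<Prod>j\<in>UNIV - {i}. h j ((y - ?e) $ j)) = (\<Prod>j\<in>UNIV - {i}. h j (y $ j))"
        by (rule prod.cong) (auto simp: axis_def)
      then have 3: "?p (y - ?e) = h i (y $ i - s) * (\<Prod>j\<in>UNIV - {i}. h j (y $ j))"
        by (subst 2) (simp only:, simp add: axis_def)
      show ?thesis by (simp only: 1 3 2[of y])
    qed
    ultimately have 0: "(LINT y|lebesgue_on (box a b). (?p (y - ?e) - ?p y) *\<^sub>R u y) = 0" by simp
    have sub: "box c d \<subseteq> box a b'" "box c d \<subseteq> box a b"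
      unfolding subset_iff mem_box_cart using c d b' by (meson le_less_trans less_le_trans order_trans)+
    have out: "?p (y - ?e) = 0" if "y \<notin> box a b" for y
    proof (rule bump_prod_eq_0)
      have "y \<in> box a b" if "y - ?e \<in> box c d"
        unfolding mem_box_cart
      proof (intro allI conjI)
        fix j
        have 1: "c $ j < (y - ?e) $ j" "(y - ?e) $ j < d $ j" using that unfolding mem_box_cart by auto
        have "?e $ j \<ge> 0" using s by (simp add: axis_def)
        then show "a $ j < y $ j" using 1(1) c[of j] by simp
        show "y $ j < b $ j" using 1(2) d[of j] by (simp add: b'_def)
      qed
      then show "y - ?e \<notin> box c d" using that by blast
    qed
    have 1: "(LINT y|lebesgue_on (box a b). (?p (y - ?e) - ?p y) *\<^sub>R u y)
      = (LINT y|lborel. (?p (y - ?e) - ?p y) *\<^sub>R u y)"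
      using out sub(2) bump_prod_eq_0[of _ c d n]
      by (intro lebesgue_on_integral_lborel continuous_intros pt pc u) auto
    have i1: "integrable lborel (\<lambda>y. ?p (y - ?e) *\<^sub>R u y)"
      using out by (intro integrable_continuous_outside_box[of _ a b] continuous_intros pt u) auto
    have i2: "integrable lborel (\<lambda>y. ?p y *\<^sub>R u y)"
      using bump_prod_eq_0[of _ c d n]
      by (intro integrable_continuous_outside_box[of _ c d] continuous_intros pc u) auto
    have i3: "integrable lborel (\<lambda>y. ?p y *\<^sub>R u (y + ?e))"
      using bump_prod_eq_0[of _ c d n]
      by (intro integrable_continuous_outside_box[of _ c d] continuous_intros pc ut) auto
    have tr: "(LINT y|lborel. ?p (y - ?e) *\<^sub>R u y) = (LINT y|lborel. ?p y *\<^sub>R u (y + ?e))"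
      using lborel_integral_translate[of "\<lambda>y. ?p (y - ?e) *\<^sub>R u y" ?e]
      by (simp add: continuous_on_scaleR[OF pt u] add.commute)
    have "(LINT y|lebesgue_on (box a b'). ?p y *\<^sub>R f y) = (LINT y|lborel. ?p y *\<^sub>R f y)"
      using sub(1) bump_prod_eq_0[of _ c d n]
      by (intro lebesgue_on_integral_lborel continuous_intros pc f) auto
    also have "\<dots> = (LINT y|lborel. ?p y *\<^sub>R u (y + ?e)) - (LINT y|lborel. ?p y *\<^sub>R u y)"
      unfolding f_def using i2 i3 by (simp add: scaleR_diff_right)
    also have "\<dots> = (LINT y|lborel. (?p (y - ?e) - ?p y) *\<^sub>R u y)"
      using i1 i2 tr by (simp add: scaleR_diff_left)
    finally show "(LINT y|lebesgue_on (box a b'). ?p y *\<^sub>R f y) = 0" using 0 1 by simp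
  qed
  moreover have "x \<in> box a b'"
    unfolding mem_box_cart
  proof (intro allI conjI)
    fix j
    show "a $ j < x $ j" using x(1) unfolding mem_box_cart by blast
    have "(x + ?e) $ j < b $ j" using x(2) unfolding mem_box_cart by blast
    then show "x $ j < b' $ j" by (simp add: b'_def)
  qed
  ultimately have "f x = 0" using continuous_AE_zero[OF f open_box] by blast
  then show ?thesis by (simp add: f_def)
qed

lemma zero_weak_gradient_imp_constant:
  fixes u :: "real^'n \<Rightarrow> 'b::euclidean_space" and a b :: "real^'n"
  assumes u: "continuous_on UNIV u"
    and z: "\<And>\<theta> i. \<theta> \<in> test_functions (box a b) \<Longrightarrow>
      (LINT x|lebesgue_on (box a b). pderivative i \<theta> x *\<^sub>R u x) = 0"
    and "x \<in> box a b" "y \<in> box a b"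
  shows "u x = u y"
proof -
  have step: "u x = u y" if xy: "x \<in> box a b" "y \<in> box a b" "y = x + r *\<^sub>R axis i 1" for x y r i
  proof (cases r "0::real" rule: linorder_cases)
    case less
    then have "x = y + (- r) *\<^sub>R axis i 1" using xy by simp
    then show ?thesis
      using zero_weak_gradient_imp_translation_invariant[OF u z, where i=i and s="- r" and x=y] xy less by simp
  next
    case greater
    then show ?thesis
      using zero_weak_gradient_imp_translation_invariant[OF u z, where i=i and s=r and x=x] xy greater by simp
  qed (use xy in auto)
  have "u x = u y" if "finite I" "x \<in> box a b" "y \<in> box a b" "\<forall>i. i \<notin> I \<longrightarrow> x $ i = y $ i" for I x y
    using that
  proof (induction I arbitrary: x rule: finite_induct)
    case empty
    then have "x = y" by (simp add: vec_eq_iff)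
    then show ?case by simp
  next
    case (insert j I)
    define x' where "x' = x + (y $ j - x $ j) *\<^sub>R axis j 1"
    have x'_nth: "x' $ i = (if i = j then y $ j else x $ i)" for i by (simp add: x'_def axis_def)
    have x': "x' \<in> box a b" using insert.prems(1,2) unfolding mem_box_cart x'_nth by auto
    have "u x = u x'" using step[OF insert.prems(1) x' x'_def] .
    also have "u x' = u y"
      using insert.prems(3) by (intro insert.IH x' insert.prems(2)) (auto simp: x'_nth)
    finally show ?case .
  qed
  from this[OF finite[of UNIV] assms(3,4)] show ?thesis by blast
qed

section \<open>Weak gradients\<close>

lemma L2_iff:
  "u \<in> L2 S \<longleftrightarrow> u \<in> borel_measurable (lebesgue_on S) \<and> integrable (lebesgue_on S) (\<lambda>x. (norm (u x))\<^sup>2)"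
  by (simp add: L2_def)

lemma L2_norm_mult_integrable:
  fixes u :: "real^'n \<Rightarrow> 'b::euclidean_space" and v :: "real^'n \<Rightarrow> 'c::euclidean_space"
  assumes "u \<in> L2 S" "v \<in> L2 S"
  shows "integrable (lebesgue_on S) (\<lambda>x. norm (u x) * norm (v x))"
proof (rule Bochner_Integration.integrable_bound)
  show "integrable (lebesgue_on S) (\<lambda>x. (norm (u x))\<^sup>2 + (norm (v x))\<^sup>2)"
    using assms by (simp add: L2_iff)
  show "(\<lambda>x. norm (u x) * norm (v x)) \<in> borel_measurable (lebesgue_on S)"
    using assms by (auto simp: L2_iff)
  have "norm (u x) * norm (v x) \<le> (norm (u x))\<^sup>2 + (norm (v x))\<^sup>2" for x
    using sum_squares_bound[of "norm (u x)" "norm (v x)"]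
      mult_nonneg_nonneg[OF norm_ge_zero[of "u x"] norm_ge_zero[of "v x"]] by linarith
  then show "AE x in lebesgue_on S. norm (norm (u x) * norm (v x)) \<le> norm ((norm (u x))\<^sup>2 + (norm (v x))\<^sup>2)"
    by (intro AE_I2) simp
qed

lemma L2_add:
  fixes u v :: "real^'n \<Rightarrow> 'b::euclidean_space"
  assumes "u \<in> L2 S" "v \<in> L2 S"
  shows "(\<lambda>x. u x + v x) \<in> L2 S"
  unfolding L2_iff
proof
  show m: "(\<lambda>x. u x + v x) \<in> borel_measurable (lebesgue_on S)"
    using assms by (auto simp: L2_iff)
  show "integrable (lebesgue_on S) (\<lambda>x. (norm (u x + v x))\<^sup>2)"
  proof (rule Bochner_Integration.integrable_bound)
    show "integrable (lebesgue_on S) (\<lambda>x. (norm (u x))\<^sup>2 + (norm (v x))\<^sup>2 + 2 * (norm (u x) * norm (v x)))"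
      using assms L2_norm_mult_integrable[OF assms] by (auto simp: L2_iff)
    show "(\<lambda>x. (norm (u x + v x))\<^sup>2) \<in> borel_measurable (lebesgue_on S)"
      using m by measurable
    have "(norm (u x + v x))\<^sup>2 \<le> (norm (u x))\<^sup>2 + (norm (v x))\<^sup>2 + 2 * (norm (u x) * norm (v x))" for x
      using power_mono[OF norm_triangle_ineq[of "u x" "v x"] norm_ge_zero, where n=2]
      by (simp add: power2_sum)
    then show "AE x in lebesgue_on S. norm ((norm (u x + v x))\<^sup>2) \<le>
        norm ((norm (u x))\<^sup>2 + (norm (v x))\<^sup>2 + 2 * (norm (u x) * norm (v x)))"
      by (intro AE_I2) simp
  qed
qed

lemma L2_linear:
  fixes u :: "real^'n \<Rightarrow> 'b::euclidean_space" and T :: "'b \<Rightarrow> 'c::euclidean_space"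
  assumes "linear T" "u \<in> L2 S"
  shows "(\<lambda>x. T (u x)) \<in> L2 S"
proof -
  have T: "bounded_linear T" using assms(1) by (simp add: linear_conv_bounded_linear)
  have m: "(\<lambda>x. T (u x)) \<in> borel_measurable (lebesgue_on S)"
    by (rule measurable_compose[of u _ borel T])
      (use assms(2) in \<open>auto simp: L2_iff intro!: borel_measurable_continuous_onI linear_continuous_on T\<close>)
  obtain K where K: "\<And>x. norm (T x) \<le> norm x * K" "K > 0"
    using bounded_linear.pos_bounded[OF T] by auto
  have "integrable (lebesgue_on S) (\<lambda>x. (norm (T (u x)))\<^sup>2)"
  proof (rule Bochner_Integration.integrable_bound)
    show "integrable (lebesgue_on S) (\<lambda>x. (norm (u x))\<^sup>2 * K\<^sup>2)"
      using assms by (auto simp: L2_iff)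
    show "(\<lambda>x. (norm (T (u x)))\<^sup>2) \<in> borel_measurable (lebesgue_on S)"
      using m by measurable
    show "AE x in lebesgue_on S. norm ((norm (T (u x)))\<^sup>2) \<le> norm ((norm (u x))\<^sup>2 * K\<^sup>2)"
      using power_mono[OF K(1) norm_ge_zero, where n=2] by (intro AE_I2) (simp add: power_mult_distrib)
  qed
  with m show ?thesis by (simp add: L2_iff)
qed

lemma L2_nth: "F \<in> L2 S \<Longrightarrow> (\<lambda>x. F x $ i) \<in> L2 S"
  by (rule L2_linear) (auto intro!: linearI)

lemma lmeasurable_open_bounded: "open S \<Longrightarrow> bounded S \<Longrightarrow> S \<in> lmeasurable"
  by (simp add: lmeasurable_open)

lemma L2_integrable:
  fixes u :: "real^'n \<Rightarrow> 'b::euclidean_space"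
  assumes "u \<in> L2 S" "open S" "bounded S"
  shows "integrable (lebesgue_on S) u"
proof -
  interpret finite_measure "lebesgue_on S"
    using assms by (intro finite_measure_lebesgue_on lmeasurable_open_bounded)
  have "norm (u x) \<le> 1 + (norm (u x))\<^sup>2" for x
    using sum_squares_bound[of "norm (u x)" 1] norm_ge_zero[of "u x"]
    unfolding power_one mult_1_right by linarith
  then show ?thesis using assms(1)
    by (intro Bochner_Integration.integrable_bound[of _ "\<lambda>x. 1 + (norm (u x))\<^sup>2" u])
      (auto simp: L2_iff)
qed

lemma bounded_scaleR_integrable:
  fixes u :: "real^'n \<Rightarrow> 'b::euclidean_space" and \<theta> :: "real^'n \<Rightarrow> real"
  assumes "continuous_on UNIV \<theta>" "bounded S" "open S" "integrable (lebesgue_on S) u"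
  shows "integrable (lebesgue_on S) (\<lambda>x. \<theta> x *\<^sub>R u x)"
proof -
  have "compact (\<theta> ` closure S)"
    using assms(1,2) by (intro compact_continuous_image continuous_on_subset[OF assms(1)]) auto
  then obtain C where C: "\<And>x. x \<in> S \<Longrightarrow> \<bar>\<theta> x\<bar> \<le> C"
    using compact_imp_bounded[of "\<theta> ` closure S"] closure_subset[of S] unfolding bounded_real by blast
  show ?thesis
  proof (rule Bochner_Integration.integrable_bound)
    show "integrable (lebesgue_on S) (\<lambda>x. C * norm (u x))" using assms(4) by simp
    have "\<theta> \<in> borel_measurable (lebesgue_on S)"
      using assms(3) by (intro continuous_imp_measurable_on_sets_lebesgue continuous_on_subset[OF assms(1)]) auto
    then show "(\<lambda>x. \<theta> x *\<^sub>R u x) \<in> borel_measurable (lebesgue_on S)"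
      using assms(4) by (intro borel_measurable_scaleR) auto
    have "\<bar>\<theta> x\<bar> * norm (u x) \<le> \<bar>C * norm (u x)\<bar>" if "x \<in> S" for x
      using mult_right_mono[OF C[OF that] norm_ge_zero[of "u x"]] by linarith
    then show "AE x in lebesgue_on S. norm (\<theta> x *\<^sub>R u x) \<le> norm (C * norm (u x))"
      by (intro AE_I2) (auto simp: abs_mult)
  qed
qed

lemma test_function_continuous:
  assumes "\<theta> \<in> test_functions S"
  shows "continuous_on UNIV \<theta>" "continuous_on UNIV (pderivative i \<theta>)"
proof -
  have "C_k (Suc 0) \<theta>" using assms unfolding test_functions_def by blast
  then show "continuous_on UNIV \<theta>" "continuous_on UNIV (pderivative i \<theta>)" by auto
qed

lemma has_weak_gradient_add:
  fixes u v :: "real^'n \<Rightarrow> 'b::euclidean_space"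
  assumes S: "open S" "bounded S"
    and L: "u \<in> L2 S" "v \<in> L2 S" "F \<in> L2 S" "G \<in> L2 S"
    and w: "has_weak_gradient u F S" "has_weak_gradient v G S"
  shows "has_weak_gradient (\<lambda>x. u x + v x) (\<lambda>x. F x + G x) S"
  unfolding has_weak_gradient_def
proof (intro ballI allI)
  fix \<theta> i assume t: "\<theta> \<in> test_functions S"
  note I = bounded_scaleR_integrable[OF test_function_continuous(1)[OF t] S(2,1) L2_integrable[OF _ S]]
    bounded_scaleR_integrable[OF test_function_continuous(2)[OF t, of i] S(2,1) L2_integrable[OF _ S]]
  have "(LINT x|lebesgue_on S. pderivative i \<theta> x *\<^sub>R (u x + v x))
      = (LINT x|lebesgue_on S. pderivative i \<theta> x *\<^sub>R u x) + (LINT x|lebesgue_on S. pderivative i \<theta> x *\<^sub>R v x)"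
    unfolding scaleR_add_right by (rule Bochner_Integration.integral_add[OF I(2)[OF L(1)] I(2)[OF L(2)]])
  also have "\<dots> = - (LINT x|lebesgue_on S. \<theta> x *\<^sub>R (F x $ i)) - (LINT x|lebesgue_on S. \<theta> x *\<^sub>R (G x $ i))"
    using w t unfolding has_weak_gradient_def by simp
  also have "\<dots> = - (LINT x|lebesgue_on S. \<theta> x *\<^sub>R ((F x + G x) $ i))"
    unfolding vector_add_component scaleR_add_right
    by (subst Bochner_Integration.integral_add[OF I(1)[OF L2_nth[OF L(3)]] I(1)[OF L2_nth[OF L(4)]]]) simp
  finally show "(LINT x|lebesgue_on S. pderivative i \<theta> x *\<^sub>R (u x + v x))
      = - (LINT x|lebesgue_on S. \<theta> x *\<^sub>R ((F x + G x) $ i))" .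
qed

lemma linear_map_vec:
  fixes T :: "'b::euclidean_space \<Rightarrow> 'c::euclidean_space"
  assumes "linear T"
  shows "linear (\<lambda>y::'b^'n. \<chi> i. T (y $ i))"
  by (rule linearI) (auto simp: vec_eq_iff linear_add[OF assms] linear_scale[OF assms])

lemma has_weak_gradient_linear:
  fixes u :: "real^'n \<Rightarrow> 'b::euclidean_space" and T :: "'b \<Rightarrow> 'c::euclidean_space"
  assumes S: "open S" "bounded S" and T: "linear T" and L: "u \<in> L2 S" "F \<in> L2 S"
    and w: "has_weak_gradient u F S"
  shows "has_weak_gradient (\<lambda>x. T (u x)) (\<lambda>x. \<chi> i. T (F x $ i)) S"
  unfolding has_weak_gradient_def
proof (intro ballI allI)
  fix \<theta> i assume t: "\<theta> \<in> test_functions S"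
  have bT: "bounded_linear T" using T by (simp add: linear_conv_bounded_linear)
  have com: "(LINT x|lebesgue_on S. \<eta> x *\<^sub>R T (f x)) = T (LINT x|lebesgue_on S. \<eta> x *\<^sub>R f x)"
    if "continuous_on UNIV \<eta>" "f \<in> L2 S" for \<eta> :: "real^'n \<Rightarrow> real" and f
    using integral_bounded_linear[OF bT bounded_scaleR_integrable[OF that(1) S(2,1) L2_integrable[OF that(2) S]]]
    by (simp add: linear_scale[OF T])
  show "(LINT x|lebesgue_on S. pderivative i \<theta> x *\<^sub>R T (u x))
      = - (LINT x|lebesgue_on S. \<theta> x *\<^sub>R ((\<chi> i. T (F x $ i)) $ i))"
    using w t com[OF test_function_continuous(2)[OF t, of i] L(1)]
      com[OF test_function_continuous(1)[OF t] L2_nth[OF L(2), of i]]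
    by (simp add: has_weak_gradient_def linear_neg[OF T])
qed

lemma test_function_directional_derivative:
  assumes "\<theta> \<in> test_functions S"
  shows "((\<lambda>t. \<theta> (x + t *\<^sub>R axis i 1)) has_real_derivative pderivative i \<theta> (x + s *\<^sub>R axis i 1)) (at s)"
proof -
  let ?e = "axis i 1 :: real^'a"
  have "C_k (Suc 0) \<theta>" using assms unfolding test_functions_def by blast
  then have "(\<lambda>t. \<theta> (x + s *\<^sub>R ?e + t *\<^sub>R ?e)) field_differentiable at 0" by auto
  then have "((\<lambda>t. \<theta> (x + s *\<^sub>R ?e + t *\<^sub>R ?e)) has_real_derivative pderivative i \<theta> (x + s *\<^sub>R ?e)) (at (s + - s))"
    unfolding pderivative_def by (simp add: field_differentiable_derivI)
  then have "((\<lambda>t. \<theta> (x + s *\<^sub>R ?e + (t + - s) *\<^sub>R ?e)) has_real_derivative pderivative i \<theta> (x + s *\<^sub>R ?e)) (at s)"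
    by (subst (asm) DERIV_shift)
  then show ?thesis by (simp add: algebra_simps)
qed

text \<open>
  The integrals of the difference quotients of a test function vanish by translation invariance, and
  by dominated convergence they tend to the integral of the derivative.
\<close>

lemma integral_pderivative_test_function:
  fixes S :: "(real^'n) set"
  assumes t: "\<theta> \<in> test_functions S" and S: "open S"
  shows "(LINT x|lebesgue_on S. pderivative i \<theta> x) = 0"
proof -
  let ?e = "axis i 1 :: real^'n" let ?g = "pderivative i \<theta>"
  define K where "K = closure {x. \<theta> x \<noteq> 0}"
  have K: "compact K" "K \<subseteq> S" using t by (auto simp: test_functions_def K_def)
  have \<theta>0: "\<theta> x = 0" if "x \<notin> K" for x using that closure_subset[of "{x. \<theta> x \<noteq> 0}"] by (auto simp: K_def)
  have c: "continuous_on UNIV \<theta>" "continuous_on UNIV ?g" using test_function_continuous[OF t] by auto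
  have D: "((\<lambda>t. \<theta> (x + t *\<^sub>R ?e)) has_real_derivative ?g (x + s *\<^sub>R ?e)) (at s)" for x s
    by (rule test_function_directional_derivative[OF t])
  have g0: "?g x = 0" if "x \<notin> K" for x
  proof -
    have "open ((\<lambda>t. x + t *\<^sub>R ?e) -` (- K))"
      using K(1) by (intro open_vimage) (auto intro!: continuous_intros compact_imp_closed)
    then have "\<forall>\<^sub>F t in nhds 0. t \<in> (\<lambda>t. x + t *\<^sub>R ?e) -` (- K)"
      using that by (intro eventually_nhds_in_open) auto
    then have "\<forall>\<^sub>F t in nhds 0. \<theta> (x + t *\<^sub>R ?e) = 0" by eventually_elim (auto intro: \<theta>0)
    moreover have "((\<lambda>t. \<theta> (x + t *\<^sub>R ?e)) has_real_derivative ?g x) (at 0)" using D[of x 0] by simp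
    ultimately have "((\<lambda>t. 0) has_real_derivative ?g x) (at 0)"
      by (subst (asm) DERIV_cong_ev[OF refl _ refl]) auto
    then show ?thesis using DERIV_unique[OF _ DERIV_const] by blast
  qed
  obtain C where C: "\<And>x. \<bar>?g x\<bar> \<le> C" "C \<ge> 0"
  proof -
    have "compact (?g ` K)" using K(1) by (intro compact_continuous_image continuous_on_subset[OF c(2)]) auto
    then have "bounded (?g ` K)" by (rule compact_imp_bounded)
    then obtain B where "\<forall>y\<in>?g ` K. \<bar>y\<bar> \<le> B" unfolding bounded_real by blast
    then have B: "\<bar>?g x\<bar> \<le> B" if "x \<in> K" for x using that by blast
    have "\<bar>?g x\<bar> \<le> max B 0" for x
    proof (cases "x \<in> K")
      case True
      then show ?thesis using B[OF True] by simp
    next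
      case False
      then show ?thesis using g0[OF False] by simp
    qed
    then show thesis by (rule that) simp
  qed
  obtain r where "\<forall>x\<in>K. norm x \<le> r"
    using compact_imp_bounded[OF K(1)] unfolding bounded_iff by blast
  then have r: "K \<subseteq> cball 0 r" by auto
  define w where "w x = indicator (cball 0 (r + 1)) x *\<^sub>R C" for x :: "real^'n"
  have w: "integrable lborel w" unfolding w_def by (intro borel_integrable_compact) auto
  define q where "q n x = (\<theta> ((1 / real (Suc n)) *\<^sub>R ?e + x) - \<theta> x) * real (Suc n)" for n x
  have shift: "continuous_on UNIV (\<lambda>x. \<theta> (v + x))" for v
    by (rule continuous_on_compose2[OF c(1)]) (auto intro!: continuous_intros)
  have \<theta>i: "integrable lborel \<theta>"
  proof -
    have "integrable lborel (\<lambda>x. indicator K x *\<^sub>R \<theta> x)"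
      using K(1) by (intro borel_integrable_compact continuous_on_subset[OF c(1)]) auto
    moreover have "(\<lambda>x. indicator K x *\<^sub>R \<theta> x) = \<theta>" using \<theta>0 by (auto simp: indicator_def fun_eq_iff)
    ultimately show ?thesis by simp
  qed
  have "(\<lambda>n. LINT x|lborel. q n x) \<longlonglongrightarrow> (LINT x|lborel. ?g x)"
  proof (rule integral_dominated_convergence[OF _ _ w])
    show "?g \<in> borel_measurable lborel" using c(2) by (simp add: borel_measurable_continuous_onI)
    show "q n \<in> borel_measurable lborel" for n
    proof -
      have "continuous_on UNIV (q n)" unfolding q_def by (intro continuous_intros shift c)
      then show ?thesis by (simp add: borel_measurable_continuous_onI)
    qed
    show "AE x in lborel. (\<lambda>n. q n x) \<longlonglongrightarrow> ?g x"
    proof (rule AE_I2)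
      fix x
      have "((\<lambda>h. (\<theta> (x + (0 + h) *\<^sub>R ?e) - \<theta> (x + 0 *\<^sub>R ?e)) / h) \<longlongrightarrow> ?g x) (at 0)"
        using D[of x 0] unfolding DERIV_def by simp
      moreover have "filterlim (\<lambda>n. 1 / real (Suc n)) (at 0) sequentially"
        unfolding filterlim_at using LIMSEQ_inverse_real_of_nat
        by (auto simp: inverse_eq_divide simp del: of_nat_Suc)
      ultimately have "(\<lambda>n. (\<theta> (x + (0 + 1 / real (Suc n)) *\<^sub>R ?e) - \<theta> (x + 0 *\<^sub>R ?e)) / (1 / real (Suc n))) \<longlonglongrightarrow> ?g x"
        by (rule filterlim_compose)
      then show "(\<lambda>n. q n x) \<longlonglongrightarrow> ?g x" unfolding q_def by (simp add: add.commute)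
    qed
    show "AE x in lborel. norm (q n x) \<le> w x" for n
    proof (rule AE_I2)
      fix x
      let ?t = "1 / real (Suc n)"
      have tpos: "0 < ?t" "?t \<le> 1" by auto
      show "norm (q n x) \<le> w x"
      proof (cases "x \<in> cball 0 (r + 1)")
        case True
        obtain z where "0 < z" "z < ?t"
            "\<theta> (x + ?t *\<^sub>R ?e) - \<theta> (x + 0 *\<^sub>R ?e) = (?t - 0) * ?g (x + z *\<^sub>R ?e)"
          using MVT2[OF tpos(1), of "\<lambda>t. \<theta> (x + t *\<^sub>R ?e)" "\<lambda>t. ?g (x + t *\<^sub>R ?e)"] D by blast
        then have "q n x = ?g (x + z *\<^sub>R ?e)" unfolding q_def by (simp add: add.commute)
        then show ?thesis using C(1) True by (simp add: w_def)
      next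
        case False
        have "x \<notin> K" using False r by auto
        moreover have "?t *\<^sub>R ?e + x \<notin> K"
        proof
          assume "?t *\<^sub>R ?e + x \<in> K"
          then have "norm (?t *\<^sub>R ?e + x) \<le> r" using r by auto
          moreover have "norm x \<le> norm (?t *\<^sub>R ?e + x) + norm (?t *\<^sub>R ?e)"
            using norm_triangle_ineq4[of "?t *\<^sub>R ?e + x" "?t *\<^sub>R ?e"] by simp
          moreover have "norm (?t *\<^sub>R ?e) \<le> 1" using tpos by simp
          moreover have "\<not> norm x \<le> r + 1" using False by simp
          ultimately show False by linarith
        qed
        ultimately have "q n x = 0" unfolding q_def by (simp add: \<theta>0)
        then show ?thesis using C(2) by (simp add: w_def)
      qed
    qed
  qed
  moreover have "(LINT x|lborel. q n x) = 0" for n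
  proof -
    let ?v = "(1 / real (Suc n)) *\<^sub>R ?e"
    have "integrable lborel (\<lambda>x. \<theta> (?v + x))"
    proof -
      have "integrable (distr lborel borel ((+) ?v)) \<theta>" using \<theta>i by (simp add: lborel_distr_plus)
      then show ?thesis
        by (subst (asm) integrable_distr_eq) (auto intro: borel_measurable_continuous_onI[OF c(1)])
    qed
    then show ?thesis unfolding q_def using \<theta>i lborel_integral_translate[OF c(1), of ?v] by simp
  qed
  ultimately have "(LINT x|lborel. ?g x) = 0" by (simp add: LIMSEQ_const_iff)
  then show ?thesis using lebesgue_on_integral_lborel[OF c(2) _ S] g0 K(2) by (metis subsetD)
qed

lemma L2_const:
  assumes "open S" "bounded S"
  shows "(\<lambda>x. c) \<in> L2 S"
proof -
  interpret finite_measure "lebesgue_on S"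
    using assms by (intro finite_measure_lebesgue_on lmeasurable_open_bounded)
  show ?thesis by (simp add: L2_iff)
qed

lemma has_weak_gradient_const:
  fixes c :: "'b::euclidean_space" and S :: "(real^'n) set"
  assumes "open S" "bounded S"
  shows "has_weak_gradient (\<lambda>x. c) (\<lambda>x. 0) S"
  unfolding has_weak_gradient_def
proof (intro ballI allI)
  fix \<theta> i assume t: "\<theta> \<in> test_functions S"
  show "(LINT x|lebesgue_on S. pderivative i \<theta> x *\<^sub>R c) = - (LINT x|lebesgue_on S. \<theta> x *\<^sub>R ((0::'b^'n) $ i))"
    using integral_pderivative_test_function[OF t assms(1), of i]
      bounded_scaleR_integrable[OF test_function_continuous(2)[OF t, of i] assms(2,1), of "\<lambda>x. 1::real"]
      L2_integrable[OF L2_const assms(1,2), of "1::real"] assms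
    by simp
qed

lemma H1_I: "u \<in> L2 S \<Longrightarrow> F \<in> L2 S \<Longrightarrow> has_weak_gradient u F S \<Longrightarrow> u \<in> H1 S"
  by (auto simp: H1_def)

lemma H1_weak_grad:
  assumes "u \<in> H1 S"
  shows "u \<in> L2 S" "weak_grad S u \<in> L2 S" "has_weak_gradient u (weak_grad S u) S"
proof -
  obtain F where "F \<in> L2 S \<and> has_weak_gradient u F S" using assms by (auto simp: H1_def)
  then have "weak_grad S u \<in> L2 S \<and> has_weak_gradient u (weak_grad S u) S"
    unfolding weak_grad_def by (rule someI[where P="\<lambda>F. F \<in> L2 S \<and> has_weak_gradient u F S"])
  then show "weak_grad S u \<in> L2 S" "has_weak_gradient u (weak_grad S u) S" by auto
qed (use assms in \<open>simp add: H1_def\<close>)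

lemma H1_add:
  assumes "open S" "bounded S" "u \<in> H1 S" "v \<in> H1 S"
  shows "(\<lambda>x. u x + v x) \<in> H1 S"
proof -
  note u = H1_weak_grad[OF assms(3)] and v = H1_weak_grad[OF assms(4)]
  show ?thesis
    by (rule H1_I[OF L2_add[OF u(1) v(1)] L2_add[OF u(2) v(2)]
          has_weak_gradient_add[OF assms(1,2) u(1) v(1) u(2) v(2) u(3) v(3)]])
qed

lemma H1_linear:
  fixes T :: "'b::euclidean_space \<Rightarrow> 'c::euclidean_space"
  assumes "open S" "bounded S" "linear T" "u \<in> H1 S"
  shows "(\<lambda>x. T (u x)) \<in> H1 S"
proof -
  note u = H1_weak_grad[OF assms(4)]
  show ?thesis
    by (rule H1_I[OF L2_linear[OF assms(3) u(1)] L2_linear[OF linear_map_vec[OF assms(3)] u(2)]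
          has_weak_gradient_linear[OF assms(1-3) u]])
qed

lemma H1_const: "open S \<Longrightarrow> bounded S \<Longrightarrow> (\<lambda>x. c) \<in> H1 S"
  by (rule H1_I[of _ _ "\<lambda>x. 0"]) (auto intro: L2_const has_weak_gradient_const)

lemma weak_gradient_unique:
  fixes u :: "real^'n \<Rightarrow> 'b::euclidean_space"
  assumes L: "F \<in> L2 (box a b)" "G \<in> L2 (box a b)"
    and w: "has_weak_gradient u F (box a b)" "has_weak_gradient u G (box a b)"
  shows "AE x in lebesgue_on (box a b). F x = G x"
proof -
  let ?S = "box a b"
  note I = L2_integrable[OF L2_nth open_box bounded_box]
  have "AE x in lebesgue_on ?S. F x $ i = G x $ i" for i
  proof -
    have "AE x in lebesgue_on ?S. F x $ i - G x $ i = 0"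
    proof (rule fundamental_lemma)
      show "integrable (lebesgue_on ?S) (\<lambda>x. F x $ i - G x $ i)"
        using I[OF L(1)] I[OF L(2)] by simp
      fix \<theta> assume t: "\<theta> \<in> test_functions ?S"
      note J = bounded_scaleR_integrable[OF test_function_continuous(1)[OF t] bounded_box open_box I]
      show "(LINT x|lebesgue_on ?S. \<theta> x *\<^sub>R (F x $ i - G x $ i)) = 0"
        using w t J[OF L(1)] J[OF L(2)] by (simp add: has_weak_gradient_def scaleR_diff_right)
    qed
    then show ?thesis by simp
  qed
  then have "AE x in lebesgue_on ?S. \<forall>i\<in>UNIV. F x $ i = G x $ i"
    by (intro AE_finite_allI) auto
  then show ?thesis by eventually_elim (simp add: vec_eq_iff)
qed

section \<open>The Dirichlet forms\<close>

lemma L2_cnj_mult_integrable: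
  fixes f g :: "real^'n \<Rightarrow> complex"
  assumes "f \<in> L2 S" "g \<in> L2 S"
  shows "integrable (lebesgue_on S) (\<lambda>x. f x * cnj (g x))"
proof (rule Bochner_Integration.integrable_bound[OF L2_norm_mult_integrable[OF assms]])
  show "(\<lambda>x. f x * cnj (g x)) \<in> borel_measurable (lebesgue_on S)"
    using assms L2_linear[OF bounded_linear.linear[OF bounded_linear_cnj] assms(2)]
    by (intro borel_measurable_times) (auto simp: L2_iff)
qed (auto simp: norm_mult)

text \<open>
  In the Dirichlet form the chosen weak gradients may be replaced by any others.
\<close>

lemma A0_eq:
  fixes w v :: "real^'n \<Rightarrow> complex"
  assumes "w \<in> L2 (box a b)" "F \<in> L2 (box a b)" "has_weak_gradient w F (box a b)"
    and "v \<in> L2 (box a b)" "G \<in> L2 (box a b)" "has_weak_gradient v G (box a b)"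
  shows "A0 (box a b) w v = (\<Sum>i\<in>UNIV. LINT x|lebesgue_on (box a b). F x $ i * cnj (G x $ i))"
proof -
  let ?S = "box a b"
  have w: "weak_grad ?S w \<in> L2 ?S" "has_weak_gradient w (weak_grad ?S w) ?S"
    and v: "weak_grad ?S v \<in> L2 ?S" "has_weak_gradient v (weak_grad ?S v) ?S"
    using H1_weak_grad[OF H1_I[OF assms(1-3)]] H1_weak_grad[OF H1_I[OF assms(4-6)]] by auto
  have "AE x in lebesgue_on ?S. weak_grad ?S w x = F x" "AE x in lebesgue_on ?S. weak_grad ?S v x = G x"
    using weak_gradient_unique w v assms by blast+
  then have ae: "AE x in lebesgue_on ?S.
      (\<Sum>i\<in>UNIV. weak_grad ?S w x $ i * cnj (weak_grad ?S v x $ i)) = (\<Sum>i\<in>UNIV. F x $ i * cnj (G x $ i))"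
    by eventually_elim simp
  note I = L2_cnj_mult_integrable[OF L2_nth L2_nth]
  have "A0 ?S w v = (LINT x|lebesgue_on ?S. (\<Sum>i\<in>UNIV. F x $ i * cnj (G x $ i)))"
    unfolding A0_def using I[OF w(1) v(1)] I[OF assms(2,5)]
    by (intro integral_cong_AE[OF _ _ ae] borel_measurable_sum borel_measurable_integrable) auto
  also have "\<dots> = (\<Sum>i\<in>UNIV. LINT x|lebesgue_on ?S. F x $ i * cnj (G x $ i))"
    using I[OF assms(2,5)] by (intro Bochner_Integration.integral_sum) auto
  finally show ?thesis .
qed

lemma A0_cnj:
  assumes "w \<in> H1 (box a b)" "v \<in> H1 (box a b)"
  shows "A0 (box a b) v w = cnj (A0 (box a b) w v)"
  unfolding A0_eq[OF H1_weak_grad[OF assms(1)] H1_weak_grad[OF assms(2)]]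
    A0_eq[OF H1_weak_grad[OF assms(2)] H1_weak_grad[OF assms(1)]] cnj_sum
  by (intro sum.cong refl) (simp flip: Bochner_Integration.integral_cnj add: mult.commute)

lemma A0_add_left:
  assumes "u \<in> H1 (box a b)" "w \<in> H1 (box a b)" "v \<in> H1 (box a b)"
  shows "A0 (box a b) (\<lambda>x. u x + w x) v = A0 (box a b) u v + A0 (box a b) w v"
proof -
  let ?S = "box a b"
  note u = H1_weak_grad[OF assms(1)] and w = H1_weak_grad[OF assms(2)] and v = H1_weak_grad[OF assms(3)]
  note I = L2_cnj_mult_integrable[OF L2_nth L2_nth]
  have "A0 ?S (\<lambda>x. u x + w x) v = (\<Sum>i\<in>UNIV. LINT x|lebesgue_on ?S.
      (weak_grad ?S u x + weak_grad ?S w x) $ i * cnj (weak_grad ?S v x $ i))"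
    by (rule A0_eq[OF L2_add[OF u(1) w(1)] L2_add[OF u(2) w(2)]
          has_weak_gradient_add[OF open_box bounded_box u(1) w(1) u(2) w(2) u(3) w(3)] v])
  also have "\<dots> = A0 ?S u v + A0 ?S w v"
    unfolding A0_eq[OF u v] A0_eq[OF w v] sum.distrib[symmetric]
    using I[OF u(2) v(2)] I[OF w(2) v(2)] by (intro sum.cong refl) (simp add: ring_distribs)
  finally show ?thesis .
qed

lemma A0_mult_left:
  assumes "u \<in> H1 (box a b)" "v \<in> H1 (box a b)"
  shows "A0 (box a b) (\<lambda>x. c * u x) v = c * A0 (box a b) u v"
proof -
  let ?S = "box a b"
  note u = H1_weak_grad[OF assms(1)] and v = H1_weak_grad[OF assms(2)]
  have T: "linear ((*) c)" by (rule linearI) (auto simp: algebra_simps)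
  have "A0 ?S (\<lambda>x. c * u x) v = (\<Sum>i\<in>UNIV. LINT x|lebesgue_on ?S.
      (\<chi> i. c * weak_grad ?S u x $ i) $ i * cnj (weak_grad ?S v x $ i))"
    by (rule A0_eq[OF L2_linear[OF T u(1)] L2_linear[OF linear_map_vec[OF T] u(2)]
          has_weak_gradient_linear[OF open_box bounded_box T u] v])
  then show ?thesis unfolding A0_eq[OF u v] by (simp add: sum_distrib_left mult.assoc)
qed

lemma A0_add_right:
  assumes "u \<in> H1 (box a b)" "w \<in> H1 (box a b)" "v \<in> H1 (box a b)"
  shows "A0 (box a b) v (\<lambda>x. u x + w x) = A0 (box a b) v u + A0 (box a b) v w"
  using A0_add_left[OF assms] A0_cnj[OF H1_add[OF open_box bounded_box assms(1,2)] assms(3)]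
    A0_cnj[OF assms(1,3)] A0_cnj[OF assms(2,3)] by simp

lemma A0_mult_right:
  assumes "u \<in> H1 (box a b)" "v \<in> H1 (box a b)"
  shows "A0 (box a b) v (\<lambda>x. c * u x) = cnj c * A0 (box a b) v u"
proof -
  have "(\<lambda>x. c * u x) \<in> H1 (box a b)"
    by (rule H1_linear[of _ "(*) c"]) (auto intro!: linearI simp: algebra_simps assms)
  from A0_cnj[OF this assms(2)] A0_cnj[OF assms] A0_mult_left[OF assms] show ?thesis by simp
qed

text \<open>
  Real-valued functions are embedded into the complex-valued ones, so that bilinearity of \<open>A\<^sub>1\<close>
  follows from sesquilinearity of \<open>A\<^sub>0\<close>.
\<close>

lemma A1_eq_A0:
  assumes "w \<in> H1 (box a b)" "v \<in> H1 (box a b)"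
  shows "complex_of_real (A1 (box a b) w v)
    = A0 (box a b) (\<lambda>x. complex_of_real (w x)) (\<lambda>x. complex_of_real (v x))"
proof -
  let ?S = "box a b"
  note w = H1_weak_grad[OF assms(1)] and v = H1_weak_grad[OF assms(2)]
  have T: "linear complex_of_real" by (rule linearI) (auto simp: scaleR_conv_of_real)
  have "A0 ?S (\<lambda>x. complex_of_real (w x)) (\<lambda>x. complex_of_real (v x)) =
    (\<Sum>i\<in>UNIV. LINT x|lebesgue_on ?S. (\<chi> i. complex_of_real (weak_grad ?S w x $ i)) $ i
        * cnj ((\<chi> i. complex_of_real (weak_grad ?S v x $ i)) $ i))"
    by (rule A0_eq[OF L2_linear[OF T w(1)] L2_linear[OF linear_map_vec[OF T] w(2)]
          has_weak_gradient_linear[OF open_box bounded_box T w]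
          L2_linear[OF T v(1)] L2_linear[OF linear_map_vec[OF T] v(2)]
          has_weak_gradient_linear[OF open_box bounded_box T v]])
  also have "\<dots> = (\<Sum>i\<in>UNIV. complex_of_real (LINT x|lebesgue_on ?S. weak_grad ?S w x $ i * weak_grad ?S v x $ i))"
    by (simp flip: of_real_mult)
  also have "\<dots> = complex_of_real (A1 ?S w v)"
  proof -
    have "integrable (lebesgue_on ?S) (\<lambda>x. weak_grad ?S w x $ i * weak_grad ?S v x $ i)" for i
      by (rule Bochner_Integration.integrable_bound[OF L2_norm_mult_integrable[OF L2_nth[OF w(2), of i] L2_nth[OF v(2), of i]]])
        (use L2_nth[OF w(2), of i] L2_nth[OF v(2), of i] in \<open>auto simp: L2_iff abs_mult\<close>)
    then show ?thesis unfolding A1_def by (simp add: Bochner_Integration.integral_sum)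
  qed
  finally show ?thesis ..
qed

lemma H1_of_real: "open S \<Longrightarrow> bounded S \<Longrightarrow> u \<in> H1 S \<Longrightarrow> (\<lambda>x. complex_of_real (u x)) \<in> H1 S"
  by (rule H1_linear[of _ complex_of_real]) (auto intro!: linearI simp: scaleR_conv_of_real)

lemma A1_commute: "A1 S v w = A1 S w v"
  unfolding A1_def by (simp add: mult.commute)

lemma A1_add_left:
  assumes "u \<in> H1 (box a b)" "w \<in> H1 (box a b)" "v \<in> H1 (box a b)"
  shows "A1 (box a b) (\<lambda>x. u x + w x) v = A1 (box a b) u v + A1 (box a b) w v"
proof -
  note H = H1_of_real[OF open_box bounded_box]
  have "complex_of_real (A1 (box a b) (\<lambda>x. u x + w x) v) = complex_of_real (A1 (box a b) u v + A1 (box a b) w v)"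
    using A0_add_left[OF H[OF assms(1)] H[OF assms(2)] H[OF assms(3)]]
    by (simp add: A1_eq_A0 assms H1_add[OF open_box bounded_box])
  then show ?thesis by (simp only: of_real_eq_iff)
qed

lemma A1_mult_left:
  assumes "u \<in> H1 (box a b)" "v \<in> H1 (box a b)"
  shows "A1 (box a b) (\<lambda>x. c * u x) v = c * A1 (box a b) u v"
proof -
  note H = H1_of_real[OF open_box bounded_box]
  have "(\<lambda>x. c * u x) \<in> H1 (box a b)"
    by (rule H1_linear[of _ "(*) c"]) (auto intro!: linearI simp: algebra_simps assms)
  then have "complex_of_real (A1 (box a b) (\<lambda>x. c * u x) v) = complex_of_real (c * A1 (box a b) u v)"
    using A0_mult_left[OF H[OF assms(1)] H[OF assms(2)], of "complex_of_real c"]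
    by (simp add: A1_eq_A0 assms)
  then show ?thesis by (simp only: of_real_eq_iff)
qed

lemma A1_const_right:
  assumes "u \<in> H1 (box a b)"
  shows "A1 (box a b) u (\<lambda>x. c) = 0"
proof -
  note u = H1_weak_grad[OF H1_of_real[OF open_box bounded_box assms]]
  have "complex_of_real (A1 (box a b) u (\<lambda>x. c)) = 0"
    unfolding A1_eq_A0[OF assms H1_const[OF open_box bounded_box]]
    by (subst A0_eq[OF u L2_const L2_const has_weak_gradient_const]) auto
  then show ?thesis by simp
qed

lemma A1_eq_0_imp_zero_weak_gradient:
  assumes "u \<in> H1 (box a b)" "A1 (box a b) u u = 0" "\<theta> \<in> test_functions (box a b)"
  shows "(LINT x|lebesgue_on (box a b). pderivative i \<theta> x *\<^sub>R u x) = 0"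
proof -
  let ?M = "lebesgue_on (box a b)" let ?F = "weak_grad (box a b) u"
  note u = H1_weak_grad[OF assms(1)]
  have I: "integrable ?M (\<lambda>x. ?F x $ i * ?F x $ i)" for i
    using L2_nth[OF u(2), of i] by (simp add: L2_iff power2_eq_square)
  have "AE x in ?M. (\<Sum>i\<in>UNIV. ?F x $ i * ?F x $ i) = 0"
    using assms(2) I unfolding A1_def
    by (subst (asm) integral_nonneg_eq_0_iff_AE) (auto intro!: sum_nonneg)
  then have "AE x in ?M. ?F x $ i = 0"
    by eventually_elim (subst (asm) sum_nonneg_eq_0_iff, auto)
  then have "(LINT x|?M. \<theta> x *\<^sub>R (?F x $ i)) = 0"
    by (intro integral_eq_zero_AE) (auto elim: eventually_mono)
  then show ?thesis using u(3) assms(3) by (simp add: has_weak_gradient_def)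
qed

section \<open>The finite element space\<close>

lemma fe_spaceD:
  assumes "u \<in> fe_space a b \<T> k"
  shows "continuous_on UNIV u" "u \<in> H1 (box a b)" "periodic (b - a) u"
  using assms by (auto simp: fe_space_def H1_per_def)

lemma fe_space_polynomial:
  assumes "u \<in> fe_space a b \<T> k" "K \<in> \<T>"
  obtains p where "polynomial_deg_le k p" "\<forall>x\<in>K. u x = p x"
  using assms by (auto simp: fe_space_def)

lemma fe_spaceI:
  assumes "u \<in> H1_per a b" "continuous_on UNIV u"
    and "\<And>K. K \<in> \<T> \<Longrightarrow> \<exists>p. polynomial_deg_le k p \<and> (\<forall>x\<in>K. u x = p x)"
  shows "u \<in> fe_space a b \<T> k"
  using assms by (simp add: fe_space_def)

lemma fe_space_H1_per: "u \<in> fe_space a b \<T> k \<Longrightarrow> u \<in> H1_per a b"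
  by (simp add: fe_space_def)

lemma H1_per_add:
  assumes "u \<in> H1_per a b" "v \<in> H1_per a b"
  shows "(\<lambda>x. u x + v x) \<in> H1_per a b"
  using assms by (auto simp: H1_per_def periodic_def intro: H1_add)

lemma H1_per_linear:
  fixes T :: "'b::euclidean_space \<Rightarrow> 'c::euclidean_space"
  assumes "linear T" "u \<in> H1_per a b"
  shows "(\<lambda>x. T (u x)) \<in> H1_per a b"
  using assms by (auto simp: H1_per_def periodic_def intro: H1_linear)

lemma polynomial_deg_le_add:
  assumes "polynomial_deg_le k p" "polynomial_deg_le k q"
  shows "polynomial_deg_le k (\<lambda>x. p x + q x)"
proof -
  obtain c d where
    "\<And>x. p x = (\<Sum>\<alpha> | (\<Sum>i\<in>UNIV. \<alpha> i) \<le> k. (\<Prod>i\<in>UNIV. (x $ i) ^ \<alpha> i) *\<^sub>R c \<alpha>)"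
    "\<And>x. q x = (\<Sum>\<alpha> | (\<Sum>i\<in>UNIV. \<alpha> i) \<le> k. (\<Prod>i\<in>UNIV. (x $ i) ^ \<alpha> i) *\<^sub>R d \<alpha>)"
    using assms unfolding polynomial_deg_le_def by blast
  then show ?thesis unfolding polynomial_deg_le_def
    by (intro exI[of _ "\<lambda>\<alpha>. c \<alpha> + d \<alpha>"]) (simp add: scaleR_add_right sum.distrib)
qed

lemma polynomial_deg_le_linear:
  assumes "linear T" "polynomial_deg_le k p"
  shows "polynomial_deg_le k (\<lambda>x. T (p x))"
proof -
  obtain c where
    "\<And>x. p x = (\<Sum>\<alpha> | (\<Sum>i\<in>UNIV. \<alpha> i) \<le> k. (\<Prod>i\<in>UNIV. (x $ i) ^ \<alpha> i) *\<^sub>R c \<alpha>)"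
    using assms unfolding polynomial_deg_le_def by blast
  then show ?thesis unfolding polynomial_deg_le_def
    by (intro exI[of _ "\<lambda>\<alpha>. T (c \<alpha>)"]) (simp add: linear_sum[OF assms(1)] linear_scale[OF assms(1)])
qed

lemma finite_multiindices: "finite {\<alpha> :: 'n::finite \<Rightarrow> nat. (\<Sum>i\<in>UNIV. \<alpha> i) \<le> k}"
proof (rule finite_subset)
  show "{\<alpha> :: 'n \<Rightarrow> nat. (\<Sum>i\<in>UNIV. \<alpha> i) \<le> k} \<subseteq> PiE UNIV (\<lambda>_. {..k})"
  proof
    fix \<alpha> :: "'n \<Rightarrow> nat" assume "\<alpha> \<in> {\<alpha>. (\<Sum>i\<in>UNIV. \<alpha> i) \<le> k}"
    then have "\<alpha> i \<le> k" for i using member_le_sum[of i UNIV \<alpha>] by (auto intro: order_trans)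
    then show "\<alpha> \<in> PiE UNIV (\<lambda>_. {..k})" by auto
  qed
  show "finite (PiE (UNIV :: 'n set) (\<lambda>_. {..k}))" by (intro finite_PiE) auto
qed

lemma polynomial_deg_le_const:
  fixes c :: "'b::real_vector"
  shows "polynomial_deg_le k (\<lambda>x::real^'n. c)"
proof -
  let ?A = "{\<alpha> :: 'n \<Rightarrow> nat. (\<Sum>i\<in>UNIV. \<alpha> i) \<le> k}"
  have "(\<Sum>\<alpha>\<in>?A. (\<Prod>i\<in>UNIV. (x $ i) ^ \<alpha> i) *\<^sub>R (if \<alpha> = (\<lambda>_. 0) then c else 0)) = c" for x :: "real^'n"
  proof -
    have "(\<Sum>\<alpha>\<in>?A. (\<Prod>i\<in>UNIV. (x $ i) ^ \<alpha> i) *\<^sub>R (if \<alpha> = (\<lambda>_. 0) then c else 0))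
      = (\<Sum>\<alpha>\<in>?A. if \<alpha> = (\<lambda>_. 0) then c else 0)"
      by (rule sum.cong) auto
    also have "\<dots> = c" by (subst sum.delta[OF finite_multiindices]) simp
    finally show ?thesis .
  qed
  then show ?thesis unfolding polynomial_deg_le_def
    by (intro exI[of _ "\<lambda>\<alpha>. if \<alpha> = (\<lambda>_. 0) then c else 0"]) simp
qed

lemma fe_space_add:
  assumes u: "u \<in> fe_space a b \<T> k" and v: "v \<in> fe_space a b \<T> k"
  shows "(\<lambda>x. u x + v x) \<in> fe_space a b \<T> k"
proof (rule fe_spaceI)
  fix K assume K: "K \<in> \<T>"
  obtain p where p: "polynomial_deg_le k p" "\<forall>x\<in>K. u x = p x"
    using fe_space_polynomial[OF u K] .
  obtain q where q: "polynomial_deg_le k q" "\<forall>x\<in>K. v x = q x"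
    using fe_space_polynomial[OF v K] .
  show "\<exists>p. polynomial_deg_le k p \<and> (\<forall>x\<in>K. u x + v x = p x)"
    using polynomial_deg_le_add[OF p(1) q(1)] p(2) q(2) by (intro exI[of _ "\<lambda>x. p x + q x"]) simp
qed (intro H1_per_add continuous_on_add fe_space_H1_per[OF u] fe_space_H1_per[OF v]
    fe_spaceD(1)[OF u] fe_spaceD(1)[OF v])+

lemma fe_space_linear:
  fixes T :: "'b::euclidean_space \<Rightarrow> 'c::euclidean_space"
  assumes T: "linear T" and u: "u \<in> fe_space a b \<T> k"
  shows "(\<lambda>x. T (u x)) \<in> fe_space a b \<T> k"
proof (rule fe_spaceI)
  fix K assume K: "K \<in> \<T>"
  obtain p where p: "polynomial_deg_le k p" "\<forall>x\<in>K. u x = p x"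
    using fe_space_polynomial[OF u K] .
  show "\<exists>p. polynomial_deg_le k p \<and> (\<forall>x\<in>K. T (u x) = p x)"
    using polynomial_deg_le_linear[OF T p(1)] p(2) by (intro exI[of _ "\<lambda>x. T (p x)"]) simp
next
  have "continuous_on UNIV T" using T by (simp add: linear_continuous_on linear_conv_bounded_linear)
  then show "continuous_on UNIV (\<lambda>x. T (u x))"
    by (rule continuous_on_compose2[OF _ fe_spaceD(1)[OF u]]) simp
qed (rule H1_per_linear[OF T fe_space_H1_per[OF u]])

lemma fe_space_const: "(\<lambda>x. c) \<in> fe_space a b \<T> k"
proof (rule fe_spaceI)
  show "(\<lambda>x. c) \<in> H1_per a b" by (auto simp: H1_per_def periodic_def intro: H1_const)
  show "\<exists>p. polynomial_deg_le k p \<and> (\<forall>x\<in>K. c = p x)" for K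
    using polynomial_deg_le_const by (intro exI[of _ "\<lambda>x. c"]) simp
qed simp

lemma fe_space_mult:
  fixes u :: "real^'n \<Rightarrow> 'b::{euclidean_space, real_algebra}"
  assumes "u \<in> fe_space a b \<T> k"
  shows "(\<lambda>x. c * u x) \<in> fe_space a b \<T> k"
  by (rule fe_space_linear[OF _ assms, of "(*) c"]) (auto intro!: linearI simp: algebra_simps)

lemma subspace_fe_space: "subspace (fe_space a b \<T> k)"
proof (rule subspaceI)
  show "0 \<in> fe_space a b \<T> k" unfolding zero_fun_def by (rule fe_space_const)
  show "u + v \<in> fe_space a b \<T> k" if "u \<in> fe_space a b \<T> k" "v \<in> fe_space a b \<T> k" for u v
    unfolding plus_fun_def using that by (rule fe_space_add)
  show "c *\<^sub>R u \<in> fe_space a b \<T> k" if "u \<in> fe_space a b \<T> k" for c u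
    unfolding scaleR_fun_def
    by (rule fe_space_linear[OF _ that, of "(*\<^sub>R) c"]) (auto intro!: linearI simp: algebra_simps)
qed

lemma periodic_int_shift:
  assumes "periodic p u"
  shows "u (x + (of_int m * p $ i) *\<^sub>R axis i 1) = u x"
proof -
  have nat: "u (x + (real n * p $ i) *\<^sub>R axis i 1) = u x" for n x
  proof (induction n)
    case (Suc n)
    have "x + (real (Suc n) * p $ i) *\<^sub>R axis i 1 = (x + (real n * p $ i) *\<^sub>R axis i 1) + (p $ i) *\<^sub>R axis i 1"
      by (simp add: algebra_simps)
    then have "u (x + (real (Suc n) * p $ i) *\<^sub>R axis i 1) = u (x + (real n * p $ i) *\<^sub>R axis i 1)"
      using assms unfolding periodic_def by (simp only:)
    then show ?case using Suc.IH by simp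
  qed simp
  show ?thesis
  proof (cases "m \<ge> 0")
    case True
    then show ?thesis using nat[of x "nat m"] by simp
  next
    case False
    have "u (x + (of_int m * p $ i) *\<^sub>R axis i 1 + (real (nat (- m)) * p $ i) *\<^sub>R axis i 1)
      = u (x + (of_int m * p $ i) *\<^sub>R axis i 1)" by (rule nat)
    moreover have "x + (of_int m * p $ i) *\<^sub>R axis i 1 + (real (nat (- m)) * p $ i) *\<^sub>R axis i 1 = x"
      using False by (simp flip: scaleR_add_left add: add.assoc)
    ultimately show ?thesis by simp
  qed
qed

text \<open>
  Every point is congruent modulo the periods to a point of the closed box; one such point serves for
  all periodic functions at once.
\<close>

lemma periodic_representative:
  fixes a b x :: "real^'n"
  assumes ab: "\<forall>i. a $ i < b $ i"
  obtains y where "y \<in> cbox a b" "\<And>u::real^'n \<Rightarrow> 'b. periodic (b - a) u \<Longrightarrow> u y = u x"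
proof -
  define m where "m i = - \<lfloor>(x $ i - a $ i) / (b $ i - a $ i)\<rfloor>" for i
  define y where "y = x + (\<Sum>i\<in>UNIV. (of_int (m i) * (b - a) $ i) *\<^sub>R axis i 1)"
  have y_nth: "y $ j = x $ j + of_int (m j) * (b $ j - a $ j)" for j
  proof -
    have "(\<Sum>i\<in>UNIV. (of_int (m i) * (b - a) $ i) *\<^sub>R axis i (1::real)) $ j
      = (\<Sum>i\<in>UNIV. if i = j then of_int (m i) * (b - a) $ i else 0)"
      unfolding sum_component by (rule sum.cong) (auto simp: axis_def)
    then show ?thesis by (simp add: y_def)
  qed
  have "a $ j \<le> y $ j \<and> y $ j \<le> b $ j" for j
  proof -
    define d where "d = b $ j - a $ j"
    define t where "t = (x $ j - a $ j) / d"
    have d: "d > 0" using ab by (simp add: d_def)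
    then have "x $ j - a $ j = t * d" by (simp add: t_def)
    then have eq: "y $ j - a $ j = (t - of_int \<lfloor>t\<rfloor>) * d"
      unfolding y_nth m_def d_def[symmetric] t_def[symmetric] by (simp add: algebra_simps)
    have "0 \<le> t - of_int \<lfloor>t\<rfloor>" "t - of_int \<lfloor>t\<rfloor> \<le> 1" by linarith+
    then have "0 \<le> (t - of_int \<lfloor>t\<rfloor>) * d" "(t - of_int \<lfloor>t\<rfloor>) * d \<le> 1 * d"
      using d by (auto intro: mult_right_mono)
    then show ?thesis using eq by (simp add: d_def)
  qed
  then have "y \<in> cbox a b" by (simp add: mem_box_cart)
  moreover have "u y = u x" if u: "periodic (b - a) u" for u :: "real^'n \<Rightarrow> 'b"
  proof -
    have "u (x + (\<Sum>i\<in>I. (of_int (m i) * (b - a) $ i) *\<^sub>R axis i 1)) = u x" if "finite I" for I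
      using that
    proof (induction I rule: finite_induct)
      case (insert j I)
      have "x + (\<Sum>i\<in>insert j I. (of_int (m i) * (b - a) $ i) *\<^sub>R axis i 1)
        = (x + (\<Sum>i\<in>I. (of_int (m i) * (b - a) $ i) *\<^sub>R axis i 1)) + (of_int (m j) * (b - a) $ j) *\<^sub>R axis j 1"
        using insert.hyps by (simp add: algebra_simps)
      then show ?case using insert.IH by (simp only: periodic_int_shift[OF u])
    qed simp
    then show ?thesis unfolding y_def by simp
  qed
  ultimately show thesis using that by blast
qed

lemma sum_fun_apply: "(\<Sum>i\<in>I. f i) x = (\<Sum>i\<in>I. f i x)"
  by (induction I rule: infinite_finite_induct) (auto simp: zero_fun_def plus_fun_def)

text \<open>
  A finite element function is determined by its polynomial coefficients on the elements: with a
  representative in the closed box and an element containing it chosen for each point,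
  it is a combination of finitely many functions that are monomials on one element.
\<close>

lemma fe_space_finite_dimensional:
  fixes a b :: "real^'n"
  assumes ab: "\<forall>i. a $ i < b $ i" and mesh: "mesh a b \<T>"
  obtains B :: "(real^'n \<Rightarrow> 'b::euclidean_space) set" where "finite B" "fe_space a b \<T> k \<subseteq> span B"
proof -
  \<comment> \<open>Elements overlap on their boundaries; \<open>el\<close> assigns to each point one element containing it.\<close>
  have T: "finite \<T>" "\<Union>\<T> = cbox a b" using mesh by (auto simp: mesh_def)
  have "\<exists>y. y \<in> cbox a b \<and> (\<forall>u::real^'n \<Rightarrow> 'b. periodic (b - a) u \<longrightarrow> u y = u x)" for x
    by (rule periodic_representative[OF ab, of x]) blast
  then obtain red where red: "\<And>x. red x \<in> cbox a b"
      "\<And>x (u::real^'n \<Rightarrow> 'b). periodic (b - a) u \<Longrightarrow> u (red x) = u x"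
    by metis
  have "\<exists>K\<in>\<T>. y \<in> K" if "y \<in> cbox a b" for y using that T(2) by blast
  then obtain el where el: "\<And>y. y \<in> cbox a b \<Longrightarrow> el y \<in> \<T>" "\<And>y. y \<in> cbox a b \<Longrightarrow> y \<in> el y"
    by metis
  let ?A = "{\<alpha> :: 'n \<Rightarrow> nat. (\<Sum>i\<in>UNIV. \<alpha> i) \<le> k}"
  define f where "f K \<alpha> e = (\<lambda>x. if el (red x) = K then (\<Prod>i\<in>UNIV. (red x $ i) ^ \<alpha> i) *\<^sub>R e else 0)"
    for K and \<alpha> :: "'n \<Rightarrow> nat" and e :: 'b
  define B where "B = (\<lambda>(K, \<alpha>, e). f K \<alpha> e) ` (\<T> \<times> ?A \<times> Basis)"
  have "finite B" unfolding B_def using T(1) finite_multiindices by (intro finite_imageI finite_cartesian_product) auto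
  moreover have "u \<in> span B" if u: "u \<in> fe_space a b \<T> k" for u
  proof -
    have "\<forall>K\<in>\<T>. \<exists>c. \<forall>y\<in>K. u y = (\<Sum>\<alpha>\<in>?A. (\<Prod>i\<in>UNIV. (y $ i) ^ \<alpha> i) *\<^sub>R c \<alpha>)"
    proof
      fix K assume "K \<in> \<T>"
      obtain p where "polynomial_deg_le k p" "\<forall>x\<in>K. u x = p x"
        using u \<open>K \<in> \<T>\<close> unfolding fe_space_def by blast
      then show "\<exists>c. \<forall>y\<in>K. u y = (\<Sum>\<alpha>\<in>?A. (\<Prod>i\<in>UNIV. (y $ i) ^ \<alpha> i) *\<^sub>R c \<alpha>)"
        unfolding polynomial_deg_le_def by auto
    qed
    from bchoice[OF this] obtain c where
      "\<forall>K\<in>\<T>. \<forall>y\<in>K. u y = (\<Sum>\<alpha>\<in>?A. (\<Prod>i\<in>UNIV. (y $ i) ^ \<alpha> i) *\<^sub>R c K \<alpha>)" ..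
    then have c: "u y = (\<Sum>\<alpha>\<in>?A. (\<Prod>i\<in>UNIV. (y $ i) ^ \<alpha> i) *\<^sub>R c K \<alpha>)" if "K \<in> \<T>" "y \<in> K" for K y
      using that by simp
    have "u = (\<Sum>K\<in>\<T>. \<Sum>\<alpha>\<in>?A. \<Sum>e\<in>Basis. (c K \<alpha> \<bullet> e) *\<^sub>R f K \<alpha> e)"
    proof
      fix x
      let ?K = "el (red x)" and ?mon = "\<lambda>\<alpha>. \<Prod>i\<in>UNIV. (red x $ i) ^ \<alpha> i"
      have K: "?K \<in> \<T>" using el red by blast
      have "(\<Sum>K\<in>\<T>. \<Sum>\<alpha>\<in>?A. \<Sum>e\<in>Basis. (c K \<alpha> \<bullet> e) *\<^sub>R f K \<alpha> e) x
        = (\<Sum>K\<in>\<T>. if ?K = K then \<Sum>\<alpha>\<in>?A. \<Sum>e\<in>Basis. (c K \<alpha> \<bullet> e) *\<^sub>R (?mon \<alpha> *\<^sub>R e) else 0)"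
        unfolding sum_fun_apply scaleR_fun_def f_def by (intro sum.cong refl) simp
      also have "\<dots> = (\<Sum>\<alpha>\<in>?A. \<Sum>e\<in>Basis. (c ?K \<alpha> \<bullet> e) *\<^sub>R (?mon \<alpha> *\<^sub>R e))"
        using T(1) K by simp
      also have "\<dots> = (\<Sum>\<alpha>\<in>?A. ?mon \<alpha> *\<^sub>R c ?K \<alpha>)"
      proof (rule sum.cong[OF refl])
        fix \<alpha>
        have "(\<Sum>e\<in>Basis. (c ?K \<alpha> \<bullet> e) *\<^sub>R (?mon \<alpha> *\<^sub>R e)) = ?mon \<alpha> *\<^sub>R (\<Sum>e\<in>Basis. (c ?K \<alpha> \<bullet> e) *\<^sub>R e)"
          by (simp add: scaleR_sum_right mult.commute)
        then show "(\<Sum>e\<in>Basis. (c ?K \<alpha> \<bullet> e) *\<^sub>R (?mon \<alpha> *\<^sub>R e)) = ?mon \<alpha> *\<^sub>R c ?K \<alpha>"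
          by (simp add: euclidean_representation)
      qed
      also have "\<dots> = u (red x)" using c[OF K] el(2)[OF red(1)] by simp
      also have "\<dots> = u x" using red(2)[OF fe_spaceD(3)[OF u]] .
      finally show "u x = (\<Sum>K\<in>\<T>. \<Sum>\<alpha>\<in>?A. \<Sum>e\<in>Basis. (c K \<alpha> \<bullet> e) *\<^sub>R f K \<alpha> e) x" ..
    qed
    also have "\<dots> \<in> span B"
    proof (intro span_sum span_scale span_base)
      show "f K \<alpha> e \<in> B" if "K \<in> \<T>" "\<alpha> \<in> ?A" "e \<in> Basis" for K \<alpha> e
        unfolding B_def using that by (intro image_eqI[of _ _ "(K, \<alpha>, e)"]) auto
    qed
    finally show ?thesis .
  qed
  ultimately show thesis using that by blast
qed

lemma fe_space_eq_0I:
  fixes u :: "real^'n \<Rightarrow> 'b::euclidean_space"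
  assumes ab: "\<forall>i. a $ i < b $ i" and u: "u \<in> fe_space a b \<T> k" and z: "\<And>x. x \<in> box a b \<Longrightarrow> u x = 0"
  shows "u = 0"
proof
  fix x
  obtain y where y: "y \<in> cbox a b" "u y = u x"
    using periodic_representative[OF ab, of x] fe_spaceD(3)[OF u] by metis
  have "(\<chi> i. (a $ i + b $ i) / 2) \<in> box a b" using ab by (simp add: mem_box_cart field_simps)
  then have "box a b \<noteq> {}" by blast
  then have "closure (box a b) = cbox a b" by (rule closure_box)
  then have "u y = 0"
    using continuous_constant_on_closure[of "box a b" u 0 y] continuous_on_subset[OF fe_spaceD(1)[OF u]] z y(1)
    by auto
  then show "u x = 0 x" using y(2) by (simp add: zero_fun_def)
qed

section \<open>Solvability of the three types of equations\<close>

lemma unique_representative_fe_space: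
  fixes \<beta> :: "(real^'n \<Rightarrow> 'b::euclidean_space) \<Rightarrow> (real^'n \<Rightarrow> 'b) \<Rightarrow> real"
  assumes ab: "\<forall>i. a $ i < b $ i" and mesh: "mesh a b \<T>"
    and E: "subspace E" "E \<subseteq> fe_space a b \<T> k"
    and "\<And>v. v \<in> E \<Longrightarrow> linear_on E (\<lambda>u. \<beta> u v)" "\<And>u. u \<in> E \<Longrightarrow> linear_on E (\<beta> u)"
    and "\<And>v. v \<in> E \<Longrightarrow> \<beta> v v = 0 \<Longrightarrow> v = 0"
    and "linear_on E f"
  shows "\<exists>!m. m \<in> E \<and> (\<forall>v\<in>E. \<beta> m v = f v)"
proof -
  obtain B :: "(real^'n \<Rightarrow> 'b) set" where "finite B" "fe_space a b \<T> k \<subseteq> span B"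
    using fe_space_finite_dimensional[OF ab mesh] .
  then have B: "finite B" "E \<subseteq> span B" using E(2) by auto
  show ?thesis by (rule unique_representative[OF E(1) B]) (fact assms)+
qed

lemma inner_R_commute: "inner_R S u v = inner_R S v u"
  by (simp add: inner_R_def mult.commute)

lemma inner_R_add_left:
  assumes "continuous_on UNIV u" "continuous_on UNIV w" "continuous_on UNIV v"
  shows "inner_R (box a b) (\<lambda>x. u x + w x) v = inner_R (box a b) u v + inner_R (box a b) w v"
  unfolding inner_R_def distrib_right
  by (intro Bochner_Integration.integral_add continuous_integrable_box continuous_intros assms)

lemma inner_R_scale_left: "inner_R S (\<lambda>x. c * u x) v = c * inner_R S u v"
  by (simp add: inner_R_def mult.assoc)

lemma linear_on_inner_R:
  assumes "\<And>u. u \<in> E \<Longrightarrow> continuous_on UNIV u" "continuous_on UNIV v"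
  shows "linear_on E (\<lambda>u. inner_R (box a b) u v)" "linear_on E (inner_R (box a b) v)"
proof -
  show "linear_on E (\<lambda>u. inner_R (box a b) u v)"
    by (simp add: linear_on_def plus_fun_def scaleR_fun_def inner_R_add_left inner_R_scale_left assms)
  moreover have "inner_R (box a b) v = (\<lambda>u. inner_R (box a b) u v)"
    by (rule ext) (rule inner_R_commute)
  ultimately show "linear_on E (inner_R (box a b) v)" by simp
qed

lemma fe_space_eq_0_of_square_integral:
  fixes v :: "real^'n \<Rightarrow> 'b::euclidean_space"
  assumes ab: "\<forall>i. a $ i < b $ i" and v: "v \<in> fe_space a b \<T> k"
    and "(LINT x|lebesgue_on (box a b). (norm (v x))\<^sup>2) = 0"
  shows "v = 0"
proof (rule fe_space_eq_0I[OF ab v])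
  have c: "continuous_on UNIV (\<lambda>x. (norm (v x))\<^sup>2)"
    by (intro continuous_intros fe_spaceD(1)[OF v])
  have "AE x in lebesgue_on (box a b). (norm (v x))\<^sup>2 = 0"
    using assms(3) by (subst (asm) integral_nonneg_eq_0_iff_AE[OF continuous_integrable_box[OF c]]) auto
  then show "v x = 0" if "x \<in> box a b" for x
    using continuous_AE_zero[OF c open_box _ that] by simp
qed

lemma L2_projection_unique:
  fixes f :: "real^'n \<Rightarrow> real"
  assumes ab: "\<forall>i. a $ i < b $ i" and mesh: "mesh a b \<T>" and f: "continuous_on UNIV f"
  shows "\<exists>!Z. Z \<in> fe_space a b \<T> k \<and> (\<forall>v\<in>fe_space a b \<T> k. inner_R (box a b) Z v = inner_R (box a b) f v)"
proof (rule unique_representative_fe_space[OF ab mesh subspace_fe_space subset_refl])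
  fix v :: "real^'n \<Rightarrow> real" assume v: "v \<in> fe_space a b \<T> k"
  show "linear_on (fe_space a b \<T> k) (\<lambda>u. inner_R (box a b) u v)"
    "linear_on (fe_space a b \<T> k) (inner_R (box a b) v)"
    by (rule linear_on_inner_R[OF _ fe_spaceD(1)[OF v]], erule fe_spaceD(1))+
  show "v = 0" if "inner_R (box a b) v v = 0"
    using fe_space_eq_0_of_square_integral[OF ab v] that by (simp add: inner_R_def power2_eq_square)
next
  show "linear_on (fe_space a b \<T> k) (inner_R (box a b) f)"
    by (rule linear_on_inner_R[OF _ f], erule fe_spaceD(1))
qed

lemma fe_space_mean0_iff:
  "v \<in> fe_space_mean0 a b \<T> k \<longleftrightarrow> v \<in> fe_space a b \<T> k \<and> (LINT x|lebesgue_on (box a b). v x) = 0"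
  by (auto simp: fe_space_mean0_def H1_per_mean0_def fe_space_def)

lemma subspace_fe_space_mean0: "subspace (fe_space_mean0 a b \<T> k)"
proof (rule subspaceI)
  note S = subspace_fe_space[of a b \<T> k]
  note I = continuous_integrable_box[OF fe_spaceD(1)]
  show "0 \<in> fe_space_mean0 a b \<T> k"
    using subspace_0[OF S] by (simp add: fe_space_mean0_iff zero_fun_def)
  show "u + v \<in> fe_space_mean0 a b \<T> k"
    if "u \<in> fe_space_mean0 a b \<T> k" "v \<in> fe_space_mean0 a b \<T> k" for u v
    using that subspace_add[OF S, of u v] I[of u a b \<T> k a b] I[of v a b \<T> k a b]
    by (simp add: fe_space_mean0_iff plus_fun_def)
  show "c *\<^sub>R u \<in> fe_space_mean0 a b \<T> k" if "u \<in> fe_space_mean0 a b \<T> k" for c u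
    using that subspace_scale[OF S, of u c] by (simp add: fe_space_mean0_iff scaleR_fun_def)
qed

lemma measure_lebesgue_on_box_pos:
  fixes a b :: "real^'n"
  assumes "\<forall>i. a $ i < b $ i"
  shows "measure (lebesgue_on (box a b)) (space (lebesgue_on (box a b))) > 0"
proof -
  have "(\<chi> i. (a $ i + b $ i) / 2) \<in> box a b" using assms by (simp add: mem_box_cart field_simps)
  then have "\<not> negligible (box a b)" using open_not_negligible[OF open_box] by blast
  then have "measure lebesgue (box a b) \<noteq> 0" by (simp add: negligible_iff_measure0)
  then have "measure lebesgue (box a b) > 0" by (simp add: zero_less_measure_iff)
  then show ?thesis by (simp add: measure_restrict_space)
qed

lemma A1_definite_mean0:
  assumes ab: "\<forall>i. a $ i < b $ i" and v: "v \<in> fe_space_mean0 a b \<T> k" and z: "A1 (box a b) v v = 0"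
  shows "v = 0"
proof -
  have v': "v \<in> fe_space a b \<T> k" and m: "(LINT x|lebesgue_on (box a b). v x) = 0"
    using v by (auto simp: fe_space_mean0_iff)
  have w: "(LINT x|lebesgue_on (box a b). pderivative i \<theta> x *\<^sub>R v x) = 0"
    if "\<theta> \<in> test_functions (box a b)" for \<theta> i
    by (rule A1_eq_0_imp_zero_weak_gradient[OF fe_spaceD(2)[OF v'] z that])
  have const: "v x = v y" if "x \<in> box a b" "y \<in> box a b" for x y
    using zero_weak_gradient_imp_constant[where u=v and a=a and b=b, OF fe_spaceD(1)[OF v'] w that]
    by simp
  show ?thesis
  proof (rule fe_space_eq_0I[OF ab v'])
    fix x assume x: "x \<in> box a b"
    have "(LINT y|lebesgue_on (box a b). v y) = (LINT y|lebesgue_on (box a b). v x)"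
      by (rule Bochner_Integration.integral_cong[OF refl], rule const[OF _ x]) simp
    then have "measure (lebesgue_on (box a b)) (space (lebesgue_on (box a b))) * v x = 0" using m by simp
    then show "v x = 0" using measure_lebesgue_on_box_pos[OF ab] by simp
  qed
qed

text \<open>
  The solution has mean value zero, but the equation holds for all test functions: the constants,
  which are missing in the space of mean value zero, satisfy it because \<open>f\<close> has mean value zero.
\<close>

lemma Poisson_unique:
  fixes f :: "real^'n \<Rightarrow> real"
  assumes ab: "\<forall>i. a $ i < b $ i" and mesh: "mesh a b \<T>" and f: "continuous_on UNIV f"
    and mean: "(LINT x|lebesgue_on (box a b). f x) = 0"
  shows "\<exists>!\<phi>. \<phi> \<in> fe_space_mean0 a b \<T> k \<and>
    (\<forall>w\<in>fe_space a b \<T> k. A1 (box a b) \<phi> w = inner_R (box a b) f w)"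
proof -
  let ?S = "box a b" and ?E = "fe_space a b \<T> k :: (real^'n \<Rightarrow> real) set"
    and ?Z = "fe_space_mean0 a b \<T> k"
  have E0: "?Z \<subseteq> ?E" by (auto simp: fe_space_mean0_def)
  have H1: "u \<in> H1 ?S" if "u \<in> ?Z" for u by (rule fe_spaceD(2)[OF subsetD[OF E0 that]])
  have ex1: "\<exists>!\<phi>. \<phi> \<in> ?Z \<and> (\<forall>w\<in>?Z. A1 ?S \<phi> w = inner_R ?S f w)"
  proof (rule unique_representative_fe_space[OF ab mesh subspace_fe_space_mean0 E0])
    fix v assume v: "v \<in> ?Z"
    show l: "linear_on ?Z (\<lambda>u. A1 ?S u v)"
      using H1 v by (simp add: linear_on_def plus_fun_def scaleR_fun_def A1_add_left A1_mult_left)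
    have "A1 ?S v = (\<lambda>u. A1 ?S u v)" by (rule ext) (rule A1_commute)
    then show "linear_on ?Z (A1 ?S v)" using l by simp
    show "v = 0" if "A1 ?S v v = 0" using A1_definite_mean0[OF ab v that] .
  next
    show "linear_on ?Z (inner_R ?S f)"
      by (rule linear_on_inner_R[OF _ f], rule fe_spaceD(1), erule subsetD[OF E0])
  qed
  have ext: "A1 ?S \<phi> w = inner_R ?S f w"
    if \<phi>: "\<phi> \<in> ?Z" and eq: "\<forall>w\<in>?Z. A1 ?S \<phi> w = inner_R ?S f w" and w: "w \<in> ?E" for \<phi> w
  proof -
    define M where "M = measure (lebesgue_on ?S) (space (lebesgue_on ?S))"
    define c where "c = (LINT x|lebesgue_on ?S. w x) / M"
    define w0 where "w0 = (\<lambda>x. w x + - c)"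
    have M: "M > 0" unfolding M_def by (rule measure_lebesgue_on_box_pos[OF ab])
    have w0E: "w0 \<in> ?E" unfolding w0_def by (intro fe_space_add w fe_space_const)
    have "(LINT x|lebesgue_on ?S. w0 x) = (LINT x|lebesgue_on ?S. w x) + (LINT x|lebesgue_on ?S. - c)"
      unfolding w0_def
      by (intro Bochner_Integration.integral_add continuous_integrable_box fe_spaceD(1)[OF w] continuous_intros)
    also have "\<dots> = 0" using M by (simp add: c_def M_def)
    finally have w0: "w0 \<in> ?Z" using w0E by (simp add: fe_space_mean0_iff)
    have w_eq: "w = (\<lambda>x. w0 x + c)" by (simp add: w0_def)
    have "A1 ?S \<phi> w = A1 ?S \<phi> w0"
    proof -
      have "A1 ?S (\<lambda>x. w0 x + c) \<phi> = A1 ?S w0 \<phi> + A1 ?S (\<lambda>x. c) \<phi>"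
        by (rule A1_add_left[OF H1[OF w0] H1_const[OF open_box bounded_box] H1[OF \<phi>]])
      moreover have "A1 ?S (\<lambda>x. c) \<phi> = 0"
        by (subst A1_commute) (rule A1_const_right[OF H1[OF \<phi>]])
      ultimately show ?thesis unfolding A1_commute[of ?S \<phi>] using w_eq by simp
    qed
    also have "\<dots> = inner_R ?S f w0" using eq w0 by blast
    also have "\<dots> = inner_R ?S f w"
    proof -
      have "inner_R ?S (\<lambda>x. w0 x + c) f = inner_R ?S w0 f + inner_R ?S (\<lambda>x. c) f"
        by (intro inner_R_add_left fe_spaceD(1)[OF w0E] f continuous_intros)
      moreover have "inner_R ?S (\<lambda>x. c) f = 0" using mean by (simp add: inner_R_def)
      ultimately show ?thesis unfolding inner_R_commute[of ?S f] using w_eq by simp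
    qed
    finally show ?thesis .
  qed
  from ex1 obtain \<phi> where \<phi>: "\<phi> \<in> ?Z" "\<forall>w\<in>?Z. A1 ?S \<phi> w = inner_R ?S f w" by blast
  show ?thesis
  proof (rule ex1I[of _ \<phi>])
    show "\<phi> \<in> ?Z \<and> (\<forall>w\<in>?E. A1 ?S \<phi> w = inner_R ?S f w)" using ext[OF \<phi>] \<phi>(1) by simp
    fix \<phi>' assume \<phi>': "\<phi>' \<in> ?Z \<and> (\<forall>w\<in>?E. A1 ?S \<phi>' w = inner_R ?S f w)"
    then have "\<phi>' \<in> ?Z \<and> (\<forall>w\<in>?Z. A1 ?S \<phi>' w = inner_R ?S f w)" using E0 by auto
    then show "\<phi>' = \<phi>" using ex1 \<phi> by auto
  qed
qed

lemma inner_C_add_left: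
  assumes "continuous_on UNIV u" "continuous_on UNIV w" "continuous_on UNIV v"
  shows "inner_C (box a b) (\<lambda>x. u x + w x) v = inner_C (box a b) u v + inner_C (box a b) w v"
  unfolding inner_C_def distrib_right
  by (intro Bochner_Integration.integral_add continuous_integrable_box continuous_intros assms)

lemma inner_C_add_right:
  assumes "continuous_on UNIV u" "continuous_on UNIV w" "continuous_on UNIV v"
  shows "inner_C (box a b) v (\<lambda>x. u x + w x) = inner_C (box a b) v u + inner_C (box a b) v w"
  unfolding inner_C_def complex_cnj_add distrib_left
  by (intro Bochner_Integration.integral_add continuous_integrable_box continuous_intros assms)

lemma inner_C_mult_left: "inner_C S (\<lambda>x. c * u x) v = c * inner_C S u v"
  by (simp add: inner_C_def mult.assoc)

lemma inner_C_mult_right: "inner_C S u (\<lambda>x. c * v x) = cnj c * inner_C S u v"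
  unfolding inner_C_def by (simp add: mult.left_commute)

lemma inner_C_weighted_self:
  "inner_C S (\<lambda>x. complex_of_real (W x) * v x) v = complex_of_real (LINT x|lebesgue_on S. W x * (cmod (v x))\<^sup>2)"
proof -
  have "complex_of_real (W x) * v x * cnj (v x) = complex_of_real (W x * (cmod (v x))\<^sup>2)" for x
    by (simp add: complex_norm_square mult.assoc del: of_real_power)
  then show ?thesis unfolding inner_C_def by (simp only: integral_complex_of_real)
qed

text \<open>
  The sesquilinear form of the equation for the midpoint \<open>m\<close>, with a known real-valued potential \<open>W\<close>.
  At \<open>(v, v)\<close> its imaginary part is \<open>2/\<tau>\<close> times the squared norm of \<open>v\<close>, because the Dirichlet
  form and the potential term are real there.
\<close>

definition midpoint_form ::
    "(real^'n) set \<Rightarrow> real \<Rightarrow> (real^'n \<Rightarrow> real) \<Rightarrow> (real^'n \<Rightarrow> complex) \<Rightarrow> (real^'n \<Rightarrow> complex) \<Rightarrow> complex" where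
  "midpoint_form S \<tau> W m v = 2 * \<i> / complex_of_real \<tau> * inner_C S m v - 1/2 * A0 S m v
     - inner_C S (\<lambda>x. complex_of_real (W x) * m x) v"

lemma midpoint_equation_unique:
  fixes \<psi> :: "real^'n \<Rightarrow> complex"
  assumes ab: "\<forall>i. a $ i < b $ i" and mesh: "mesh a b \<T>" and \<tau>: "\<tau> > 0"
    and W: "continuous_on UNIV W" and \<psi>: "continuous_on UNIV \<psi>"
  shows "\<exists>!m. m \<in> fe_space a b \<T> k \<and> (\<forall>v\<in>fe_space a b \<T> k.
    midpoint_form (box a b) \<tau> W m v = 2 * \<i> / complex_of_real \<tau> * inner_C (box a b) \<psi> v)"
proof -
  let ?S = "box a b" and ?E = "fe_space a b \<T> k :: (real^'n \<Rightarrow> complex) set"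
  let ?B = "midpoint_form ?S \<tau> W"
  let ?l = "\<lambda>v. 2 * \<i> / complex_of_real \<tau> * inner_C ?S \<psi> v"
  note cont = fe_spaceD(1) and H1 = fe_spaceD(2)
  have W': "continuous_on UNIV (\<lambda>x. complex_of_real (W x) * m x)" if "m \<in> ?E" for m
    by (intro continuous_intros W cont[OF that])
  have Badd_l: "?B (\<lambda>x. u x + w x) v = ?B u v + ?B w v" if "u \<in> ?E" "w \<in> ?E" "v \<in> ?E" for u w v
    unfolding midpoint_form_def using that
    by (simp add: inner_C_add_left A0_add_left cont H1 W' distrib_left)
  have Badd_r: "?B v (\<lambda>x. u x + w x) = ?B v u + ?B v w" if "u \<in> ?E" "w \<in> ?E" "v \<in> ?E" for u w v
    unfolding midpoint_form_def using that
    by (simp add: inner_C_add_right A0_add_right cont H1 W' distrib_left)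
  have Bmult_l: "?B (\<lambda>x. c * u x) v = c * ?B u v" if "u \<in> ?E" "v \<in> ?E" for c u v
  proof -
    have "(\<lambda>x. complex_of_real (W x) * (c * u x)) = (\<lambda>x. c * (complex_of_real (W x) * u x))"
      by (simp add: mult.left_commute)
    then show ?thesis unfolding midpoint_form_def
      by (simp only: inner_C_mult_left A0_mult_left[OF H1[OF that(1)] H1[OF that(2)]]) (simp add: algebra_simps)
  qed
  have Bmult_r: "?B u (\<lambda>x. c * v x) = cnj c * ?B u v" if "u \<in> ?E" "v \<in> ?E" for c u v
    unfolding midpoint_form_def inner_C_mult_right A0_mult_right[OF H1[OF that(2)] H1[OF that(1)]]
    by (simp add: algebra_simps)
  have ex1: "\<exists>!m. m \<in> ?E \<and> (\<forall>v\<in>?E. Im (?B m v) = Im (?l v))"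
  proof (rule unique_representative_fe_space[OF ab mesh subspace_fe_space subset_refl])
    fix v assume v: "v \<in> ?E"
    show "linear_on ?E (\<lambda>u. Im (?B u v))" "linear_on ?E (\<lambda>u. Im (?B v u))"
      using v by (simp_all add: linear_on_def plus_fun_def scaleR_fun_def scaleR_conv_of_real
          Badd_l Badd_r Bmult_l Bmult_r)
    assume z: "Im (?B v v) = 0"
    have "inner_C ?S v v = complex_of_real (LINT x|lebesgue_on ?S. (cmod (v x))\<^sup>2)"
      using inner_C_weighted_self[of ?S "\<lambda>x. 1" v] by simp
    moreover have "Im (A0 ?S v v) = 0"
      using arg_cong[OF A0_cnj[OF H1[OF v] H1[OF v]], of Im] by simp
    ultimately have "Im (?B v v) = 2 / \<tau> * (LINT x|lebesgue_on ?S. (cmod (v x))\<^sup>2)"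
      unfolding midpoint_form_def inner_C_weighted_self by simp
    then show "v = 0" using z \<tau> fe_space_eq_0_of_square_integral[OF ab v] by simp
  next
    show "linear_on ?E (\<lambda>v. Im (?l v))"
      by (simp add: linear_on_def plus_fun_def scaleR_fun_def scaleR_conv_of_real
          inner_C_add_right inner_C_mult_right cont \<psi> distrib_left add_divide_distrib)
  qed
  \<comment> \<open>Testing with \<open>\<i> v\<close> instead of \<open>v\<close> turns imaginary into real parts.\<close>
  have "(\<forall>v\<in>?E. Im (?B m v) = Im (?l v)) \<longleftrightarrow> (\<forall>v\<in>?E. ?B m v = ?l v)" if m: "m \<in> ?E" for m
  proof
    assume *: "\<forall>v\<in>?E. Im (?B m v) = Im (?l v)"
    show "\<forall>v\<in>?E. ?B m v = ?l v"
    proof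
      fix v assume v: "v \<in> ?E"
      have "Im (?B m (\<lambda>x. \<i> * v x)) = Im (?l (\<lambda>x. \<i> * v x))"
        using * fe_space_mult[OF v] by blast
      moreover have "?l (\<lambda>x. \<i> * v x) = cnj \<i> * ?l v"
        unfolding inner_C_mult_right by simp
      ultimately have "Im (cnj \<i> * ?B m v) = Im (cnj \<i> * ?l v)"
        unfolding Bmult_r[OF m v] by (simp only:)
      then have "Re (?B m v) = Re (?l v)" by simp
      then show "?B m v = ?l v" using * v by (intro complex_eqI) auto
    qed
  qed simp
  then show ?thesis using ex1 by (metis (no_types, lifting))
qed

lemma Schroedinger_step_unique:
  fixes \<psi> :: "real^'n \<Rightarrow> complex"
  assumes ab: "\<forall>i. a $ i < b $ i" and mesh: "mesh a b \<T>" and \<tau>: "\<tau> > 0"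
    and W: "continuous_on UNIV W" and \<psi>: "\<psi> \<in> fe_space a b \<T> k"
  shows "\<exists>!\<psi>'. \<psi>' \<in> fe_space a b \<T> k \<and> (\<forall>v\<in>fe_space a b \<T> k.
    inner_C (box a b) (\<lambda>x. \<i> * D_tau \<tau> \<psi>' \<psi> x) v =
      1/2 * A0 (box a b) (midpt \<psi>' \<psi>) v +
      inner_C (box a b) (\<lambda>x. complex_of_real (W x) * midpt \<psi>' \<psi> x) v)"
proof -
  let ?S = "box a b" and ?E = "fe_space a b \<T> k :: (real^'n \<Rightarrow> complex) set"
  let ?l = "\<lambda>v. 2 * \<i> / complex_of_real \<tau> * inner_C ?S \<psi> v"
  let ?P = "\<lambda>m. \<forall>v\<in>?E. midpoint_form ?S \<tau> W m v = ?l v"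
  let ?Q = "\<lambda>\<psi>'. \<forall>v\<in>?E. inner_C ?S (\<lambda>x. \<i> * D_tau \<tau> \<psi>' \<psi> x) v =
      1/2 * A0 ?S (midpt \<psi>' \<psi>) v + inner_C ?S (\<lambda>x. complex_of_real (W x) * midpt \<psi>' \<psi> x) v"
  have midE: "midpt \<psi>' \<psi> \<in> ?E" if "\<psi>' \<in> ?E" for \<psi>'
  proof -
    have "midpt \<psi>' \<psi> = (\<lambda>x. 1/2 * (\<psi>' x + \<psi> x))" by (simp add: midpt_def fun_eq_iff)
    then show ?thesis using fe_space_mult[OF fe_space_add[OF that \<psi>], of "1/2"] by simp
  qed
  have PQ: "?P (midpt \<psi>' \<psi>) \<longleftrightarrow> ?Q \<psi>'" if p: "\<psi>' \<in> ?E" for \<psi>'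
  proof (rule ball_cong[OF refl])
    fix v assume v: "v \<in> ?E"
    have "(\<lambda>x. \<i> * D_tau \<tau> \<psi>' \<psi> x) = (\<lambda>x. (2 * \<i> / complex_of_real \<tau>) * (midpt \<psi>' \<psi> x + (-1) * \<psi> x))"
      using \<tau> by (auto simp: D_tau_def midpt_def fun_eq_iff field_simps)
    moreover have "inner_C ?S (\<lambda>x. midpt \<psi>' \<psi> x + (-1) * \<psi> x) v
        = inner_C ?S (midpt \<psi>' \<psi>) v + (-1) * inner_C ?S \<psi> v"
      using inner_C_add_left[OF fe_spaceD(1)[OF midE[OF p]] fe_spaceD(1)[OF fe_space_mult[OF \<psi>, of "-1"]] fe_spaceD(1)[OF v]]
      by (simp only: inner_C_mult_left)
    ultimately have "inner_C ?S (\<lambda>x. \<i> * D_tau \<tau> \<psi>' \<psi> x) v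
        = 2 * \<i> / complex_of_real \<tau> * inner_C ?S (midpt \<psi>' \<psi>) v - ?l v"
      by (simp only: inner_C_mult_left) (simp add: algebra_simps)
    then show "midpoint_form ?S \<tau> W (midpt \<psi>' \<psi>) v = ?l v \<longleftrightarrow>
      inner_C ?S (\<lambda>x. \<i> * D_tau \<tau> \<psi>' \<psi> x) v =
      1/2 * A0 ?S (midpt \<psi>' \<psi>) v + inner_C ?S (\<lambda>x. complex_of_real (W x) * midpt \<psi>' \<psi> x) v"
      unfolding midpoint_form_def by (auto simp: algebra_simps)
  qed
  have ex1: "\<exists>!m. m \<in> ?E \<and> ?P m"
    by (rule midpoint_equation_unique[OF ab mesh \<tau> W fe_spaceD(1)[OF \<psi>]])
  then obtain m where m: "m \<in> ?E" "?P m" by blast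
  define \<psi>' where "\<psi>' = (\<lambda>x. 2 * m x + (-1) * \<psi> x)"
  have \<psi>': "\<psi>' \<in> ?E" unfolding \<psi>'_def by (intro fe_space_add fe_space_mult m \<psi>)
  have mid: "midpt \<psi>' \<psi> = m" by (simp add: \<psi>'_def midpt_def fun_eq_iff)
  show ?thesis
  proof (rule ex1I[of _ \<psi>'])
    show "\<psi>' \<in> ?E \<and> ?Q \<psi>'" using \<psi>' PQ[OF \<psi>'] m(2) unfolding mid by blast
    fix \<psi>'' assume "\<psi>'' \<in> ?E \<and> ?Q \<psi>''"
    then have "midpt \<psi>'' \<psi> \<in> ?E \<and> ?P (midpt \<psi>'' \<psi>)" using midE PQ by blast
    then have "midpt \<psi>'' \<psi> = midpt \<psi>' \<psi>" using ex1 m mid by blast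
    then show "\<psi>'' = \<psi>'" by (simp add: midpt_def fun_eq_iff)
  qed
qed

section \<open>One step of the scheme\<close>

theorem lemma2p2:
  fixes a b :: "real^'n"
    and \<T> :: "(real^'n) set set"
    and \<sigma> g G q \<tau> :: real
    and k :: nat
    and \<psi>p \<psi>m :: "real^'n \<Rightarrow> complex"
    and \<phi> Zp Zm :: "real^'n \<Rightarrow> real"
  assumes "CARD('n) \<in> {1, 2, 3}"
    and "\<forall>i. a $ i < b $ i"
    and "mesh a b \<T>" and "shape_regular \<sigma> \<T>"
    and "k \<ge> 1"
    and "\<tau> > 0"
    and "\<psi>p \<in> fe_space a b \<T> k" and "\<psi>m \<in> fe_space a b \<T> k"
    and "\<phi> \<in> fe_space_mean0 a b \<T> k"
    and "Zp \<in> fe_space a b \<T> k" and "Zm \<in> fe_space a b \<T> k"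
    and "(\<integral>x. (cmod (\<psi>p x))\<^sup>2 - (cmod (\<psi>m x))\<^sup>2 \<partial>lebesgue_on (box a b)) = 0"
    and "(\<integral>x. Zp x - Zm x \<partial>lebesgue_on (box a b)) = 0"
  shows "\<exists>!(\<psi>p', \<psi>m', \<phi>', Zp', Zm').
    \<psi>p' \<in> fe_space a b \<T> k \<and> \<psi>m' \<in> fe_space a b \<T> k \<and>
    \<phi>' \<in> fe_space_mean0 a b \<T> k \<and>
    Zp' \<in> fe_space a b \<T> k \<and> Zm' \<in> fe_space a b \<T> k \<and>
    (\<forall>vp \<in> fe_space a b \<T> k. \<forall>vm \<in> fe_space a b \<T> k.
     \<forall>w \<in> fe_space a b \<T> k. \<forall>\<chi>p \<in> fe_space a b \<T> k. \<forall>\<chi>m \<in> fe_space a b \<T> k.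
      inner_C (box a b) (\<lambda>x. \<i> * D_tau \<tau> \<psi>p' \<psi>p x) vp =
        1/2 * A0 (box a b) (midpt \<psi>p' \<psi>p) vp +
        inner_C (box a b)
          (\<lambda>x. complex_of_real (g * Zp' x + G * Zm' x + q * \<phi>' x) * midpt \<psi>p' \<psi>p x) vp \<and>
      inner_C (box a b) (\<lambda>x. \<i> * D_tau \<tau> \<psi>m' \<psi>m x) vm =
        1/2 * A0 (box a b) (midpt \<psi>m' \<psi>m) vm +
        inner_C (box a b)
          (\<lambda>x. complex_of_real (g * Zm' x + G * Zp' x - q * \<phi>' x) * midpt \<psi>m' \<psi>m x) vm \<and>
      A1 (box a b) \<phi>' w = inner_R (box a b) (\<lambda>x. 4 * pi * q * (Zp' x - Zm' x)) w \<and>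
      inner_R (box a b) (\<lambda>x. Zp' x + Zp x) \<chi>p =
        inner_R (box a b) (\<lambda>x. 2 * (cmod (\<psi>p x))\<^sup>2) \<chi>p \<and>
      inner_R (box a b) (\<lambda>x. Zm' x + Zm x) \<chi>m =
        inner_R (box a b) (\<lambda>x. 2 * (cmod (\<psi>m x))\<^sup>2) \<chi>m)"
proof -
  let ?S = "box a b" and ?R = "fe_space a b \<T> k :: (real^'n \<Rightarrow> real) set"
    and ?C = "fe_space a b \<T> k :: (real^'n \<Rightarrow> complex) set"
  note ab = assms(2) and mesh = assms(3) and \<tau> = assms(6) and \<psi>p = assms(7) and \<psi>m = assms(8)
    and Zp = assms(10) and Zm = assms(11)
  note cont = fe_spaceD(1)
  have zeroR: "(\<lambda>x. 0) \<in> ?R" and zeroC: "(\<lambda>x. 0) \<in> ?C" by (rule fe_space_const)+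
  have dens: "continuous_on UNIV (\<lambda>x. 2 * (cmod (\<psi> x))\<^sup>2)" if "\<psi> \<in> ?C" for \<psi>
    by (intro continuous_intros cont[OF that])
  have Z_eq: "inner_R ?S (\<lambda>x. Z' x + Z x) \<xi> = inner_R ?S (\<lambda>x. 2 * (cmod (\<psi> x))\<^sup>2) \<xi> \<longleftrightarrow>
      inner_R ?S Z' \<xi> = inner_R ?S (\<lambda>x. 2 * (cmod (\<psi> x))\<^sup>2 + (-1) * Z x) \<xi>"
    if Z: "Z \<in> ?R" "Z' \<in> ?R" "\<xi> \<in> ?R" "\<psi> \<in> ?C" for Z Z' \<xi> \<psi>
  proof -
    have "inner_R ?S (\<lambda>x. 2 * (cmod (\<psi> x))\<^sup>2 + (-1) * Z x) \<xi>
        = inner_R ?S (\<lambda>x. 2 * (cmod (\<psi> x))\<^sup>2) \<xi> + (-1) * inner_R ?S Z \<xi>"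
      using inner_R_add_left[OF dens[OF Z(4)] cont[OF fe_space_mult[OF Z(1), of "-1"]] cont[OF Z(3)]]
      by (simp only: inner_R_scale_left)
    then show ?thesis using inner_R_add_left[OF cont[OF Z(2)] cont[OF Z(1)] cont[OF Z(3)], of a b] by auto
  qed
  have Z_ex1: "\<exists>!Z'. Z' \<in> ?R \<and> (\<forall>\<xi>\<in>?R. inner_R ?S (\<lambda>x. Z' x + Z x) \<xi> = inner_R ?S (\<lambda>x. 2 * (cmod (\<psi> x))\<^sup>2) \<xi>)"
    if Z: "Z \<in> ?R" "\<psi> \<in> ?C" for Z \<psi>
  proof -
    have "continuous_on UNIV (\<lambda>x. 2 * (cmod (\<psi> x))\<^sup>2 + (-1) * Z x)"
      by (intro continuous_intros cont[OF Z(1)] cont[OF Z(2)])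
    from L2_projection_unique[OF ab mesh this, of k] show ?thesis
      using Z_eq[OF Z(1) _ _ Z(2)] by (simp cong: conj_cong)
  qed
  obtain Zp' where Zp': "Zp' \<in> ?R" "\<forall>\<xi>\<in>?R. inner_R ?S (\<lambda>x. Zp' x + Zp x) \<xi> = inner_R ?S (\<lambda>x. 2 * (cmod (\<psi>p x))\<^sup>2) \<xi>"
    using ex1_implies_ex[OF Z_ex1[OF Zp \<psi>p]] by blast
  obtain Zm' where Zm': "Zm' \<in> ?R" "\<forall>\<xi>\<in>?R. inner_R ?S (\<lambda>x. Zm' x + Zm x) \<xi> = inner_R ?S (\<lambda>x. 2 * (cmod (\<psi>m x))\<^sup>2) \<xi>"
    using ex1_implies_ex[OF Z_ex1[OF Zm \<psi>m]] by blast
  define f where "f = (\<lambda>x. 4 * pi * q * (Zp' x - Zm' x))"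
  have f: "continuous_on UNIV f"
    unfolding f_def by (intro continuous_intros cont[OF Zp'(1)] cont[OF Zm'(1)])
  \<comment> \<open>Testing the equations for the potentials with the constant 1 gives the compatibility condition
    of the Poisson equation.\<close>
  have mean: "(LINT x|lebesgue_on ?S. f x) = 0"
  proof -
    note I = continuous_integrable_box[of _ a b]
    have one: "(\<lambda>x. 1) \<in> ?R" by (rule fe_space_const)
    have s: "integrable (lebesgue_on ?S) (\<lambda>x. (cmod (\<psi> x))\<^sup>2)" if "\<psi> \<in> ?C" for \<psi>
      by (intro I continuous_intros cont[OF that])
    note i = I[OF cont[OF Zp]] I[OF cont[OF Zm]] I[OF cont[OF Zp'(1)]] I[OF cont[OF Zm'(1)]] s[OF \<psi>p] s[OF \<psi>m]
    have "(LINT x|lebesgue_on ?S. Zp' x) + (LINT x|lebesgue_on ?S. Zp x)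
        = 2 * (LINT x|lebesgue_on ?S. (cmod (\<psi>p x))\<^sup>2)"
      using bspec[OF Zp'(2) one] i by (simp add: inner_R_def)
    moreover have "(LINT x|lebesgue_on ?S. Zm' x) + (LINT x|lebesgue_on ?S. Zm x)
        = 2 * (LINT x|lebesgue_on ?S. (cmod (\<psi>m x))\<^sup>2)"
      using bspec[OF Zm'(2) one] i by (simp add: inner_R_def)
    moreover have "(LINT x|lebesgue_on ?S. (cmod (\<psi>p x))\<^sup>2) = (LINT x|lebesgue_on ?S. (cmod (\<psi>m x))\<^sup>2)"
      using assms(12) i by simp
    moreover have "(LINT x|lebesgue_on ?S. Zp x) = (LINT x|lebesgue_on ?S. Zm x)"
      using assms(13) i by simp
    ultimately have "(LINT x|lebesgue_on ?S. Zp' x) = (LINT x|lebesgue_on ?S. Zm' x)" by linarith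
    then show ?thesis unfolding f_def using i by simp
  qed
  note \<phi>_ex1 = Poisson_unique[OF ab mesh f mean, of k]
  obtain \<phi>' where \<phi>': "\<phi>' \<in> fe_space_mean0 a b \<T> k" "\<forall>w\<in>?R. A1 ?S \<phi>' w = inner_R ?S f w"
    using ex1_implies_ex[OF \<phi>_ex1] by blast
  have \<phi>'R: "\<phi>' \<in> ?R" using \<phi>'(1) by (simp add: fe_space_mean0_iff)
  have Wp: "continuous_on UNIV (\<lambda>x. g * Zp' x + G * Zm' x + q * \<phi>' x)"
    and Wm: "continuous_on UNIV (\<lambda>x. g * Zm' x + G * Zp' x - q * \<phi>' x)"
    by (intro continuous_intros cont[OF Zp'(1)] cont[OF Zm'(1)] cont[OF \<phi>'R])+
  note \<psi>p_ex1 = Schroedinger_step_unique[OF ab mesh \<tau> Wp \<psi>p]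
  note \<psi>m_ex1 = Schroedinger_step_unique[OF ab mesh \<tau> Wm \<psi>m]
  obtain \<psi>p' where \<psi>p': "\<psi>p' \<in> ?C" "\<forall>v\<in>?C. inner_C ?S (\<lambda>x. \<i> * D_tau \<tau> \<psi>p' \<psi>p x) v =
      1/2 * A0 ?S (midpt \<psi>p' \<psi>p) v +
      inner_C ?S (\<lambda>x. complex_of_real (g * Zp' x + G * Zm' x + q * \<phi>' x) * midpt \<psi>p' \<psi>p x) v"
    using ex1_implies_ex[OF \<psi>p_ex1] by blast
  obtain \<psi>m' where \<psi>m': "\<psi>m' \<in> ?C" "\<forall>v\<in>?C. inner_C ?S (\<lambda>x. \<i> * D_tau \<tau> \<psi>m' \<psi>m x) v =
      1/2 * A0 ?S (midpt \<psi>m' \<psi>m) v +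
      inner_C ?S (\<lambda>x. complex_of_real (g * Zm' x + G * Zp' x - q * \<phi>' x) * midpt \<psi>m' \<psi>m x) v"
    using ex1_implies_ex[OF \<psi>m_ex1] by blast
  show ?thesis
  proof (rule ex1I[of _ "(\<psi>p', \<psi>m', \<phi>', Zp', Zm')"], goal_cases)
    case 1
    show ?case
      unfolding prod.case
      using \<psi>p' \<psi>m' \<phi>' Zp' Zm' unfolding f_def by (intro conjI ballI) (assumption | erule (1) bspec | simp)+
  next
    case (2 sol)
    obtain P M F Y X where sol: "sol = (P, M, F, Y, X)" by (cases sol)
    note spaces_eqs = 2[unfolded sol prod.case]
    have sp: "P \<in> ?C" "M \<in> ?C" "F \<in> fe_space_mean0 a b \<T> k" "Y \<in> ?R" "X \<in> ?R"
      using spaces_eqs by blast+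
    note all = spaces_eqs[THEN conjunct2, THEN conjunct2, THEN conjunct2, THEN conjunct2, THEN conjunct2]
    have eqs: "\<forall>\<xi>\<in>?R. inner_R ?S (\<lambda>x. Y x + Zp x) \<xi> = inner_R ?S (\<lambda>x. 2 * (cmod (\<psi>p x))\<^sup>2) \<xi>"
      "\<forall>\<xi>\<in>?R. inner_R ?S (\<lambda>x. X x + Zm x) \<xi> = inner_R ?S (\<lambda>x. 2 * (cmod (\<psi>m x))\<^sup>2) \<xi>"
      "\<forall>w\<in>?R. A1 ?S F w = inner_R ?S (\<lambda>x. 4 * pi * q * (Y x - X x)) w"
      "\<forall>v\<in>?C. inner_C ?S (\<lambda>x. \<i> * D_tau \<tau> P \<psi>p x) v = 1/2 * A0 ?S (midpt P \<psi>p) v +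
        inner_C ?S (\<lambda>x. complex_of_real (g * Y x + G * X x + q * F x) * midpt P \<psi>p x) v"
      "\<forall>v\<in>?C. inner_C ?S (\<lambda>x. \<i> * D_tau \<tau> M \<psi>m x) v = 1/2 * A0 ?S (midpt M \<psi>m) v +
        inner_C ?S (\<lambda>x. complex_of_real (g * X x + G * Y x - q * F x) * midpt M \<psi>m x) v"
      using all zeroR zeroC by blast+
    have Y: "Y = Zp'" using Z_ex1[OF Zp \<psi>p] Zp' sp(4) eqs(1) by blast
    have X: "X = Zm'" using Z_ex1[OF Zm \<psi>m] Zm' sp(5) eqs(2) by blast
    have F: "F = \<phi>'"
      using \<phi>_ex1 \<phi>' sp(3) eqs(3)[unfolded Y X, folded f_def] by blast
    have P: "P = \<psi>p'" using \<psi>p_ex1 \<psi>p' sp(1) eqs(4)[unfolded Y X F] by blast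
    have M: "M = \<psi>m'" using \<psi>m_ex1 \<psi>m' sp(2) eqs(5)[unfolded Y X F] by blast
    show ?case unfolding sol Y X F P M ..
  qed
qed

end
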